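(* Let $F$ be a field of characteristic $\neq 2$, let $O$ be a Cayley algebra over $F$, $V=\operatorname{im}(O)$, and let $\mathcal{B}$ be the set of all three-dimensional associative subspaces of $V$. Then $(V,\mathcal{B})$ is a $(7,3,2)$ $q$-covering design which is inclusion-minimal (no proper subcollection of $\mathcal{B}$ covers all 2-dimensional subspaces of $V$), and it is a $2$-$(7,3,1)$ subspace design ($q$-Fano plane) if and only if $O$ is a division algebra. Moreover $\mathcal{B}=\{\operatorname{im}(H): H \text{ a 4-dimensional subalgebra of } O\}$.
   Context: All algebras are finite-dimensional unital, not necessarily associative $F$-algebras; subalgebras contain $1$. Cayley–Dickson algebras: $F$ with identity involution; if $A$ is one with involution $*$ and $\gamma\in F^\times$, then $D_\gamma(A)=A\oplus A$ (elements $a+ib$) with $(a+ib)(c+id)=(ac+\gamma db^* )+i(a^*d+cb)$ and $(a+ib)^*=a^*-ib$. A Cayley algebra is $D_\gamma(D_\beta(D_\alpha(F)))$, $\alpha,\beta,\gamma\in F^\times$; $\operatorname{im}(O)=\{a: a^*=-a\}$. A linear subspace $S$ of an algebra is associative if $(xy)z=x(yz)$ for all $x,y,z\in S$ (the products need not lie in $S$). A division algebra has no zero divisors. A $(v,k,t)$ $q$-covering design: a set of $k$-dimensional subspaces of a $v$-dimensional space such that every $t$-dimensional subspace lies in at least one of them; a $2$-$(7,3,1)$ subspace design: every 2-dimensional subspace lies in exactly one. *)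

theory Defs
  imports Main "HOL.Vector_Spaces" "HOL-Library.Function_Algebras"
begin

text \<open>An element of the n-th Cayley--Dickson algebra D(F) (dimension 2^n) is represented
  as a function x :: nat => 'f with x i = 0 for i >= 2^n. The element a + i b of
  D_gamma(A) (A of dimension 2^n) is the function whose first 2^n coordinates are those
  of a and whose next 2^n coordinates are those of b. Vector space operations are
  pointwise.\<close>

definition sc :: "'f::field \<Rightarrow> (nat \<Rightarrow> 'f) \<Rightarrow> (nat \<Rightarrow> 'f)" where
  "sc c x = (\<lambda>i. c * x i)"

definition cd_fst :: "nat \<Rightarrow> (nat \<Rightarrow> 'f::zero) \<Rightarrow> (nat \<Rightarrow> 'f)" where
  "cd_fst n x = (\<lambda>i. if i < 2^n then x i else 0)"

definition cd_snd :: "nat \<Rightarrow> (nat \<Rightarrow> 'f::zero) \<Rightarrow> (nat \<Rightarrow> 'f)" where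
  "cd_snd n x = (\<lambda>i. if i < 2^n then x (i + 2^n) else 0)"

definition cd_join :: "nat \<Rightarrow> (nat \<Rightarrow> 'f::zero) \<Rightarrow> (nat \<Rightarrow> 'f) \<Rightarrow> (nat \<Rightarrow> 'f)" where
  "cd_join n a b = (\<lambda>i. if i < 2^n then a i else if i < 2^(Suc n) then b (i - 2^n) else 0)"

fun cd_conj :: "nat \<Rightarrow> (nat \<Rightarrow> 'f::field) \<Rightarrow> (nat \<Rightarrow> 'f)" where
  "cd_conj 0 x = (\<lambda>i. if i = 0 then x 0 else 0)"
| "cd_conj (Suc n) x = cd_join n (cd_conj n (cd_fst n x)) (- cd_snd n x)"

text \<open>Multiplication; gs ! n is the parameter gamma of the (n+1)-st doubling:
  (a+ib)(c+id) = (ac + gamma d b^*) + i(a^* d + c b).\<close>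
fun cd_mult :: "'f::field list \<Rightarrow> nat \<Rightarrow> (nat \<Rightarrow> 'f) \<Rightarrow> (nat \<Rightarrow> 'f) \<Rightarrow> (nat \<Rightarrow> 'f)" where
  "cd_mult gs 0 x y = (\<lambda>i. if i = 0 then x 0 * y 0 else 0)"
| "cd_mult gs (Suc n) x y =
     (let a = cd_fst n x; b = cd_snd n x; c = cd_fst n y; d = cd_snd n y in
      cd_join n (cd_mult gs n a c + sc (gs ! n) (cd_mult gs n d (cd_conj n b)))
                (cd_mult gs n (cd_conj n a) d + cd_mult gs n c b))"

definition oct_carrier :: "(nat \<Rightarrow> 'f::zero) set" where
  "oct_carrier = {x. \<forall>i\<ge>8. x i = 0}"

definition oct_mult :: "'f::field \<Rightarrow> 'f \<Rightarrow> 'f \<Rightarrow> (nat \<Rightarrow> 'f) \<Rightarrow> (nat \<Rightarrow> 'f) \<Rightarrow> (nat \<Rightarrow> 'f)" where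
  "oct_mult \<alpha> \<beta> \<gamma> = cd_mult [\<alpha>, \<beta>, \<gamma>] 3"

definition oct_conj :: "(nat \<Rightarrow> 'f::field) \<Rightarrow> (nat \<Rightarrow> 'f)" where
  "oct_conj = cd_conj 3"

definition oct_one :: "nat \<Rightarrow> 'f::{zero,one}" where
  "oct_one = (\<lambda>i. if i = 0 then 1 else 0)"

definition oct_im :: "(nat \<Rightarrow> 'f::field) set" where
  "oct_im = {x \<in> oct_carrier. oct_conj x = - x}"

abbreviation lsubspace :: "(nat \<Rightarrow> 'f::field) set \<Rightarrow> bool" where
  "lsubspace S \<equiv> module.subspace sc S"

abbreviation ldim :: "(nat \<Rightarrow> 'f::field) set \<Rightarrow> nat" where
  "ldim S \<equiv> vector_space.dim sc S"

definition associative_subspace ::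
  "((nat \<Rightarrow> 'f) \<Rightarrow> (nat \<Rightarrow> 'f) \<Rightarrow> (nat \<Rightarrow> 'f)) \<Rightarrow> (nat \<Rightarrow> 'f) set \<Rightarrow> bool" where
  "associative_subspace m S \<longleftrightarrow> (\<forall>x\<in>S. \<forall>y\<in>S. \<forall>z\<in>S. m (m x y) z = m x (m y z))"

definition is_subalgebra ::
  "((nat \<Rightarrow> 'f::field) \<Rightarrow> (nat \<Rightarrow> 'f) \<Rightarrow> (nat \<Rightarrow> 'f)) \<Rightarrow> (nat \<Rightarrow> 'f) set \<Rightarrow> (nat \<Rightarrow> 'f) set \<Rightarrow> bool" where
  "is_subalgebra m A H \<longleftrightarrow> lsubspace H \<and> H \<subseteq> A \<and> oct_one \<in> H \<and> (\<forall>x\<in>H. \<forall>y\<in>H. m x y \<in> H)"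

definition division_algebra ::
  "((nat \<Rightarrow> 'f::field) \<Rightarrow> (nat \<Rightarrow> 'f) \<Rightarrow> (nat \<Rightarrow> 'f)) \<Rightarrow> (nat \<Rightarrow> 'f) set \<Rightarrow> bool" where
  "division_algebra m A \<longleftrightarrow> (\<forall>x\<in>A. \<forall>y\<in>A. m x y = 0 \<longrightarrow> x = 0 \<or> y = 0)"

definition q_covering_design ::
  "(nat \<Rightarrow> 'f::field) set \<Rightarrow> nat \<Rightarrow> nat \<Rightarrow> nat \<Rightarrow> (nat \<Rightarrow> 'f) set set \<Rightarrow> bool" where
  "q_covering_design V v k t B \<longleftrightarrow>
     lsubspace V \<and> ldim V = v \<and>
     (\<forall>S\<in>B. lsubspace S \<and> S \<subseteq> V \<and> ldim S = k) \<and>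
     (\<forall>W. lsubspace W \<and> W \<subseteq> V \<and> ldim W = t \<longrightarrow> (\<exists>S\<in>B. W \<subseteq> S))"

definition q_subspace_design_1 ::
  "(nat \<Rightarrow> 'f::field) set \<Rightarrow> nat \<Rightarrow> nat \<Rightarrow> nat \<Rightarrow> (nat \<Rightarrow> 'f) set set \<Rightarrow> bool" where
  "q_subspace_design_1 V t v k B \<longleftrightarrow>
     lsubspace V \<and> ldim V = v \<and>
     (\<forall>S\<in>B. lsubspace S \<and> S \<subseteq> V \<and> ldim S = k) \<and>
     (\<forall>W. lsubspace W \<and> W \<subseteq> V \<and> ldim W = t \<longrightarrow> (\<exists>!S. S \<in> B \<and> W \<subseteq> S))"

end

(*
  On V = im(O) the product is xy = -<x,y> + x \<times> y, where the cross product satisfies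
  x \<times> (x \<times> z) = -<x,x>z + <x,z>x, and the associator of imaginary elements is twice the alternating
  map A(x,y,z) = (x \<times> y) \<times> z - <x,z>y + <y,z>x.

  If x \<times> y is not in span(x,y), then A(x,y,z) = 0 forces z in span(x, y, x \<times> y): this is immediate
  when x \<times> y is anisotropic, since x \<times> y acts invertibly; otherwise one may take x in the
  radical of span(x,y), and a z outside would yield either a totally isotropic 4-space or three
  independent vectors with vanishing pairwise cross products, both impossible in dimension 7.
  Every 3-dimensional subspace contains x, y with x \<times> y not in span(x,y). So a block is the unique
  block through some plane (minimality) and is closed under \<times> (it is the imaginary part of a
  subalgebra). Planes with x \<times> y in span(x,y) still admit some z with A(x,y,z) = 0 (covering);
  they exist iff V has an isotropic vector, i.e. iff O has zero divisors, and then some plane lies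
  in two blocks.
*)

theory Submission
  imports Defs
begin

section \<open>Spans and independence\<close>

text \<open>The difficulty is that over a general field the form may have isotropic vectors, and
  then \<open>x \<otimes> y\<close> can fall back into the plane of \<open>x\<close> and
  \<open>y\<close>. The case distinctions rest on Lagrange's identity \<open>norm_cr\<close>: the
  norm of \<open>x \<otimes> y\<close> is the Gram determinant of \<open>x\<close> and
  \<open>y\<close>. So for independent \<open>x\<close>, \<open>y\<close> the product is isotropic
  exactly when the form degenerates on their plane, and that is why a radical vector is then
  available. As \<open>x \<otimes> y\<close> is orthogonal to both factors, a plane containing it is
  always degenerate. On such planes one device recurs: \<open>asc x y z\<close> and
  \<open>asc x z y\<close>, evaluated separately from the definition, come out equal, yet they are
  opposite; since 2 is nonzero, both vanish. It serves the covering property as well as the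
  existence of good pairs in every 3-space. Dimension 7 enters through two counts: mutually
  orthogonal independent sets have at most 7 elements together, and two linear conditions leave a
  subspace that four vectors cannot span.\<close>

interpretation fv: vector_space "sc :: 'f::field \<Rightarrow> (nat \<Rightarrow> 'f) \<Rightarrow> (nat \<Rightarrow> 'f)"
  by unfold_locales (auto simp: sc_def fun_eq_iff algebra_simps)

lemma in_span_1: "v \<in> fv.span {x} \<longleftrightarrow> (\<exists>a. v = sc a x)"
  by (auto simp: fv.span_singleton)

lemma in_span_2: "v \<in> fv.span {x, y} \<longleftrightarrow> (\<exists>a b. v = sc a x + sc b y)"
proof -
  have "v \<in> fv.span {x, y} \<longleftrightarrow> (\<exists>a b. v - sc a x = sc b y)"
    by (simp add: fv.span_breakdown_eq[of v x] fv.span_singleton image_iff)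
  then show ?thesis by (simp add: diff_eq_eq add.commute)
qed

lemma in_span_3: "v \<in> fv.span {x, y, z} \<longleftrightarrow> (\<exists>a b c. v = sc a x + sc b y + sc c z)"
proof -
  have "v \<in> fv.span {x, y, z} \<longleftrightarrow> (\<exists>a b c. v - sc a x = sc b y + sc c z)"
    by (simp add: fv.span_breakdown_eq[of v x] in_span_2)
  then show ?thesis by (simp add: diff_eq_eq add.commute add.left_commute)
qed

text \<open>The functional lives on the whole function space, so that \<open>riesz\<close> applies
  to it; together they yield vectors with prescribed values of \<open>ip\<close> against an
  independent subset of \<open>V\<close>.\<close>

lemma independent_extend_functional:
  fixes K :: "(nat \<Rightarrow> 'f::field) set"
  assumes "fv.independent K"
  shows "\<exists>f :: (nat \<Rightarrow> 'f) \<Rightarrow> 'f. (\<forall>x y. f (x + y) = f x + f y)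
      \<and> (\<forall>c x. f (sc c x) = c * f x) \<and> (\<forall>k\<in>K. f k = h k)"
proof -
  interpret p: vector_space_pair "sc :: 'f \<Rightarrow> (nat \<Rightarrow> 'f) \<Rightarrow> (nat \<Rightarrow> 'f)" "(*) :: 'f \<Rightarrow> 'f \<Rightarrow> 'f"
    by unfold_locales (auto simp: algebra_simps)
  obtain f where "Vector_Spaces.linear sc (*) f" and "\<forall>k\<in>K. f k = h k"
    using p.linear_independent_extend[OF assms, of h] by blast
  then show ?thesis
    by (intro exI[of _ f]) (auto simp: p.linear_add p.linear_scale)
qed

lemma scale_in_span_cancel: "sc a y \<in> fv.span S \<Longrightarrow> a \<noteq> 0
    \<Longrightarrow> y \<in> fv.span S"
  using fv.span_scale[of "sc a y" S "inverse a"] by simp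

lemma independent_insert_card:
  assumes "fv.independent S" "finite S" "a \<notin> fv.span S"
  shows "fv.independent (insert a S)" "card (insert a S) = Suc (card S)"
proof -
  have "a \<notin> S" using assms(3) by (rule contrapos_nn) (rule fv.span_base)
  then show "card (insert a S) = Suc (card S)" using assms(2) by simp
qed (rule fv.independent_insertI[OF assms(3,1)])

lemma independent_1: "x \<noteq> 0 \<Longrightarrow> fv.independent {x}"
  using fv.dependent_single by blast

lemma independent_2:
  assumes "x \<noteq> 0" "y \<notin> fv.span {x}" shows "fv.independent {y, x}" "card {y, x} = 2"
  using independent_insert_card[OF independent_1[OF assms(1)] _ assms(2)] by auto

lemma independent_3:
  assumes "x \<noteq> 0" "y \<notin> fv.span {x}" "z \<notin> fv.span {y, x}"
  shows "fv.independent {z, y, x}" "card {z, y, x} = 3"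
  using independent_insert_card[OF independent_2(1)[OF assms(1,2)] _ assms(3)] independent_2(2)[OF assms(1,2)] by auto

section \<open>Seven-dimensional cross products\<close>

text \<open>\<open>cr_cr\<close> is the left alternative law for imaginary elements. It alone among
  the identities asks for membership in \<open>V\<close>: in the intended model form and product
  read only the coordinates 1 to 7, but \<open>cr_cr\<close> returns its arguments with all their
  coordinates.\<close>

locale cross_space =
  fixes V :: "(nat \<Rightarrow> 'f::field) set"
    and ip :: "(nat \<Rightarrow> 'f) \<Rightarrow> (nat \<Rightarrow> 'f) \<Rightarrow> 'f"
    and cr :: "(nat \<Rightarrow> 'f) \<Rightarrow> (nat \<Rightarrow> 'f) \<Rightarrow> (nat \<Rightarrow> 'f)"  (infixl \<open>\<otimes>\<close> 70)
  assumes two: "(2::'f) \<noteq> 0"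
    and subspace_V: "lsubspace V" and dim_V: "ldim V = 7"
    and ip_add_left: "ip (x + y) z = ip x z + ip y z"
    and ip_sc_left: "ip (sc c x) z = c * ip x z"
    and ip_sym: "ip x y = ip y x"
    \<comment> \<open>nondegeneracy of the form, in the shape in which it is used\<close>
    and riesz: "(\<And>x y. f (x + y) = f x + f y) \<Longrightarrow> (\<And>c x. f (sc c x) = c * f x)
        \<Longrightarrow> \<exists>p\<in>V. \<forall>v\<in>V. ip p v = f v"
    and cr_V: "x \<otimes> y \<in> V"
    and cr_self: "x \<otimes> x = 0"
    and cr_add_left: "(x + y) \<otimes> z = x \<otimes> z + y \<otimes> z"
    and cr_add_right: "x \<otimes> (y + z) = x \<otimes> y + x \<otimes> z"
    and cr_sc_left: "(sc c x) \<otimes> z = sc c (x \<otimes> z)"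
    and cr_sc_right: "x \<otimes> (sc c z) = sc c (x \<otimes> z)"
    and ip_cr: "ip (x \<otimes> y) z = ip x (y \<otimes> z)"
    and cr_cr: "x \<in> V \<Longrightarrow> z \<in> V \<Longrightarrow> x \<otimes> (x \<otimes> z)
        = sc (- ip x x) z + sc (ip x z) x"
begin

section \<open>Identities for the form, the cross product and the associator\<close>

lemma ip_add_right: "ip z (x + y) = ip z x + ip z y" by (metis ip_add_left ip_sym)
lemma ip_sc_right: "ip z (sc c x) = c * ip z x" by (metis ip_sc_left ip_sym)
lemma ip_zero_left: "ip 0 z = 0" using ip_sc_left[of 0 0 z] by simp
lemma ip_zero_right: "ip z 0 = 0" by (metis ip_zero_left ip_sym)
lemma ip_minus_left: "ip (- x) z = - ip x z" using ip_sc_left[of "-1" x z] by simp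
lemma ip_minus_right: "ip z (- x) = - ip z x" by (metis ip_minus_left ip_sym)
lemma ip_diff_left: "ip (x - y) z = ip x z - ip y z" by (metis ip_add_left ip_minus_left diff_conv_add_uminus)
lemma ip_diff_right: "ip z (x - y) = ip z x - ip z y" by (metis ip_diff_left ip_sym)

lemmas ip_simps = ip_add_left ip_add_right ip_sc_left ip_sc_right ip_zero_left ip_zero_right
  ip_minus_left ip_minus_right ip_diff_left ip_diff_right

lemma cr_zero_left: "0 \<otimes> z = 0" using cr_sc_left[of 0 0 z] by simp
lemma cr_zero_right: "z \<otimes> 0 = 0" using cr_sc_right[of z 0 0] by simp
lemma cr_minus_left: "(- x) \<otimes> z = - (x \<otimes> z)" using cr_sc_left[of "-1" x z] by simp
lemma cr_minus_right: "z \<otimes> (- x) = - (z \<otimes> x)" using cr_sc_right[of z "-1" x] by simp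
lemma cr_diff_left: "(x - y) \<otimes> z = x \<otimes> z - y \<otimes> z"
    by (metis cr_add_left cr_minus_left diff_conv_add_uminus)
lemma cr_diff_right: "z \<otimes> (x - y) = z \<otimes> x - z \<otimes> y"
    by (metis cr_add_right cr_minus_right diff_conv_add_uminus)

lemmas cr_simps = cr_add_left cr_add_right cr_sc_left cr_sc_right cr_zero_left cr_zero_right
  cr_minus_left cr_minus_right cr_diff_left cr_diff_right cr_self

lemma cr_skew: "y \<otimes> x = - (x \<otimes> y)"
proof -
  have "y \<otimes> x + x \<otimes> y = (x + y) \<otimes> (x + y)"
    by (simp only: cr_add_left cr_add_right cr_self[of x] cr_self[of y] add_0_left add_0_right)
  then show ?thesis by (simp only: cr_self eq_neg_iff_add_eq_0)
qed

lemma cr_eq_0_sym: "x \<otimes> y = 0 \<Longrightarrow> y \<otimes> x = 0" by (simp add: cr_skew[of x y])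

lemma V_closed [simp, intro]:
  "0 \<in> V" "x \<in> V \<Longrightarrow> y \<in> V \<Longrightarrow> x + y \<in> V" "x \<in> V
      \<Longrightarrow> sc c x \<in> V"
  "x \<in> V \<Longrightarrow> - x \<in> V" "x \<in> V \<Longrightarrow> y \<in> V \<Longrightarrow> x
      - y \<in> V" "x \<otimes> y \<in> V"
  using subspace_V cr_V
      by (auto simp: fv.subspace_0 fv.subspace_add fv.subspace_scale fv.subspace_neg fv.subspace_diff)

lemma ip_cr_self [simp]: "ip x (x \<otimes> y) = 0" "ip y (x \<otimes> y) = 0" "ip (x \<otimes> y) x
    = 0" "ip (x \<otimes> y) y = 0"
proof -
  show 1: "ip x (x \<otimes> y) = 0" for x y by (simp add: ip_cr[symmetric] cr_simps ip_simps)
  show 2: "ip y (x \<otimes> y) = 0" for x y using 1[of y x] by (simp add: cr_skew[of y x] ip_simps)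
  show "ip (x \<otimes> y) x = 0" "ip (x \<otimes> y) y = 0" using 1 2 by (simp_all add: ip_sym[of "x \<otimes> y"])
qed

text \<open>Polarisation of \<open>cr_cr\<close> in its repeated argument. Besides making
  \<open>asc\<close> skew, it evaluates \<open>x \<otimes> (y \<otimes> z)\<close> when
  \<open>x \<otimes> z = 0\<close>.\<close>

lemma cr_cr_linear:
  assumes "x \<in> V" "y \<in> V" "z \<in> V"
  shows "x \<otimes> (y \<otimes> z) + y \<otimes> (x \<otimes> z) = sc (- 2 * ip x y) z + sc (ip x z) y
      + sc (ip y z) x"
proof -
  have "(x + y) \<otimes> ((x + y) \<otimes> z) = sc (- ip (x + y) (x + y)) z + sc (ip (x + y) z) (x + y)"
    using assms by (intro cr_cr) auto
  then have "x \<otimes> (x \<otimes> z) + y \<otimes> (y \<otimes> z) + (x \<otimes> (y \<otimes> z)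
      + y \<otimes> (x \<otimes> z)) = sc (- ip (x + y) (x + y)) z + sc (ip (x + y) z) (x + y)"
    by (simp add: cr_simps add_ac)
  then show ?thesis
    using ip_sym[of x y]
    unfolding cr_cr[OF assms(1,3)] cr_cr[OF assms(2,3)]
    by (simp add: fun_eq_iff sc_def ip_simps algebra_simps)
qed

lemma cr_cr_right:
  assumes "x \<in> V" "z \<in> V"
  shows "(z \<otimes> x) \<otimes> x = sc (- ip x x) z + sc (ip x z) x"
  using cr_cr[OF assms] by (simp add: cr_skew[of x] cr_simps)

lemma norm_cr:
  assumes "x \<in> V" "y \<in> V"
  shows "ip (x \<otimes> y) (x \<otimes> y) = ip x x * ip y y - ip x y * ip x y"
proof -
  have "ip (x \<otimes> y) (x \<otimes> y) = - ip x (y \<otimes> (y \<otimes> x))"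
    by (simp only: ip_cr cr_skew[of y x] cr_simps ip_simps minus_minus)
  then show ?thesis using assms ip_sym[of x y] by (simp add: cr_cr ip_simps)
qed

text \<open>Half of the associator of imaginary elements.\<close>
definition asc :: "(nat \<Rightarrow> 'f) \<Rightarrow> (nat \<Rightarrow> 'f) \<Rightarrow> (nat \<Rightarrow> 'f) \<Rightarrow> (nat \<Rightarrow> 'f)" where
  "asc x y z = (x \<otimes> y) \<otimes> z - sc (ip x z) y + sc (ip y z) x"

lemma asc_skew_12: "asc y x z = - asc x y z"
  by (simp add: asc_def cr_skew[of x y] cr_simps)

text \<open>Skewness in the first two arguments comes from that of \<open>\<otimes>\<close> alone;
  this transposition is where the alternative law enters. The two generate all permutations of the
  arguments.\<close>

lemma asc_skew_23:
  assumes "x \<in> V" "y \<in> V" "z \<in> V"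
  shows "asc x z y = - asc x y z"
proof -
  have "y \<otimes> (z \<otimes> x) + z \<otimes> (y \<otimes> x) = sc (- 2 * ip y z) x + sc (ip y x) z
      + sc (ip z x) y"
    using assms by (intro cr_cr_linear) auto
  then have "- (y \<otimes> (x \<otimes> z)) - z \<otimes> (x \<otimes> y) = sc (- 2 * ip y z) x + sc (ip y x) z
      + sc (ip z x) y"
    by (simp add: cr_skew[of x] cr_simps)
  then show ?thesis
    by (simp add: asc_def cr_skew[of y] cr_skew[of z] ip_sym[of y x] ip_sym[of z x] ip_sym[of z y] fun_eq_iff sc_def algebra_simps)
qed

lemma asc_rotate:
  assumes "x \<in> V" "y \<in> V" "z \<in> V"
  shows "asc y z x = asc x y z" "asc z x y = asc x y z"
  using assms asc_skew_12 asc_skew_23 by metis+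

lemma asc_self [simp]: "asc x x z = 0" by (simp add: asc_def cr_simps)

lemma asc_self' [simp]: "x \<in> V \<Longrightarrow> y \<in> V \<Longrightarrow> asc x y y = 0" "x \<in> V
    \<Longrightarrow> y \<in> V \<Longrightarrow> asc x y x = 0"
  using asc_rotate[of y y x] asc_rotate[of x x y] by auto

lemma asc_cr [simp]: "asc x y (x \<otimes> y) = 0"
  by (simp add: asc_def cr_simps)

lemma asc_add:
  "asc (x + x') y z = asc x y z + asc x' y z" "asc x (y + y') z = asc x y z + asc x y' z" "asc x y (z + z')
      = asc x y z + asc x y z'"
  by (simp_all add: asc_def cr_simps ip_simps) (simp_all add: fun_eq_iff sc_def algebra_simps)

lemma asc_sc: "asc (sc c x) y z = sc c (asc x y z)" "asc x (sc c y) z = sc c (asc x y z)" "asc x y (sc c z)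
    = sc c (asc x y z)"
  by (simp_all add: asc_def cr_simps ip_simps) (simp_all add: fun_eq_iff sc_def algebra_simps)

section \<open>Dual vectors and dimension counts\<close>

lemma riesz_independent:
  assumes "fv.independent K" "K \<subseteq> V"
  shows "\<exists>p\<in>V. \<forall>k\<in>K. ip p k = h k"
proof -
  obtain f where "\<forall>x y. f (x + y) = f x + f y" "\<forall>c x. f (sc c x)
      = c * f x" "\<forall>k\<in>K. f k = h k"
    using independent_extend_functional[OF assms(1), of h] by blast
  moreover from this obtain p where "p \<in> V" "\<forall>v\<in>V. ip p v = f v" using riesz[of f] by auto
  ultimately show ?thesis using assms(2) by (intro bexI[of _ p]) auto
qed

lemma V_basis: obtains b where "finite b" "b \<subseteq> V" "V \<subseteq> fv.span b" "fv.independent b" "card b = 7"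
proof -
  obtain b where b: "b \<subseteq> V" "fv.independent b" "V \<subseteq> fv.span b" "card b = 7"
    using fv.basis_exists[of V] dim_V by metis
  then have "finite b" by (intro card_ge_0_finite) simp
  with b that show thesis by blast
qed

lemma independent_card_le:
  assumes "fv.independent K" "K \<subseteq> V"
  shows "finite K" "card K \<le> 7"
proof -
  obtain b where b: "finite b" "V \<subseteq> fv.span b" "card b = 7" using V_basis by metis
  with assms fv.independent_span_bound[of b K] show "finite K" "card K \<le> 7" by auto
qed

lemma span_card_ge:
  assumes "finite N" "V \<subseteq> fv.span N"
  shows "7 \<le> card N"
proof -
  obtain b where b: "b \<subseteq> V" "fv.independent b" "card b = 7" using V_basis by metis
  with assms fv.independent_span_bound[of N b] show ?thesis by auto
qed

text \<open>If \<open>p\<^sub>k\<close> is dual to \<open>K\<close>, then the \<open>p\<^sub>k\<close> together with \<open>L\<close> are independent.\<close>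
lemma orthogonal_card_le:
  assumes K: "fv.independent K" "K \<subseteq> V" and L: "fv.independent L" "L \<subseteq> V"
    and orth: "\<And>k l. k \<in> K \<Longrightarrow> l \<in> L \<Longrightarrow> ip k l = 0"
  shows "card K + card L \<le> 7"
proof -
  have "\<exists>p. p \<in> V \<and> (\<forall>j\<in>K. ip p j = (if j = k then 1 else 0))" for k
    using riesz_independent[OF K, of "\<lambda>j. if j = k then 1 else 0"] by blast
  then have "\<forall>k. \<exists>p. p \<in> V \<and> (\<forall>j\<in>K. ip p j = (if j = k then 1 else 0))" by blast
  from choice[OF this] obtain p where p0: "\<forall>k. p k \<in> V \<and> (\<forall>j\<in>K. ip (p k) j = (if j
      = k then 1 else 0))" ..
  have p: "p k \<in> V" "j \<in> K \<Longrightarrow> ip (p k) j = (if j = k then 1 else 0)" for k j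
    using p0 by blast+
  have finK: "finite K" and finL: "finite L" using K L independent_card_le by auto
  have "fv.independent (p ` M \<union> L) \<and> card (p ` M \<union> L) = card M + card L" if "M \<subseteq> K" for M
    using finite_subset[OF that finK] that
  proof (induction M)
    case empty
    then show ?case using L by simp
  next
    case (insert k M)
    \<comment> \<open>Pairing with \<open>k\<close> kills the earlier \<open>p j\<close> by duality
      and \<open>L\<close> by orthogonality, but not \<open>p k\<close>, which is therefore
      new.\<close>
    have "ip x k = 0" if "x \<in> fv.span (p ` M \<union> L)" for x
      using that
    proof (induction rule: fv.span_induct_alt)
      case base
      show ?case by (rule ip_zero_left)
    next
      case (step c x y)
      moreover have "ip (p j) k = 0" if "j \<in> M" for j using that insert.prems insert.hyps by (auto simp: p(2))
      moreover have "ip l k = 0" if "l \<in> L" for l using that insert.prems orth ip_sym[of l k] by auto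
      ultimately have "ip x k = 0" by blast
      with step.IH show ?case by (simp only: ip_add_left ip_sc_left mult_zero_right add_0_right)
    qed
    moreover have "ip (p k) k = 1" using p(2)[of k k] insert.prems by simp
    ultimately have notin: "p k \<notin> fv.span (p ` M \<union> L)" by fastforce
    have notin': "p k \<notin> p ` M \<union> L" using notin by (rule contrapos_nn) (rule fv.span_base)
    have IH: "fv.independent (p ` M \<union> L)" "card (p ` M \<union> L) = card M + card L" using insert by auto
    have "p ` insert k M \<union> L = insert (p k) (p ` M \<union> L)" by blast
    moreover have "fv.independent (insert (p k) (p ` M \<union> L))"
      using notin IH(1) by (rule fv.independent_insertI)
    moreover have "card (insert (p k) (p ` M \<union> L)) = Suc (card (p ` M \<union> L))"
      using insert.hyps(1) finL notin' by (intro card_insert_disjoint) auto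
    ultimately show ?case using IH(2) insert.hyps by (simp only: card_insert_disjoint add_Suc simp_thms)
  qed
  from this[OF order_refl] have *: "fv.independent (p ` K \<union> L)" "card (p ` K \<union> L) = card K
      + card L" by auto
  moreover have "p ` K \<union> L \<subseteq> V" using p(1) L(2) by blast
  ultimately show ?thesis using independent_card_le(2) by metis
qed

lemma orthogonal_not_in_span:
  assumes "finite N" "card N \<le> 4"
  obtains r where "r \<in> V" "ip r x = 0" "ip r y = 0" "r \<notin> fv.span N"
proof -
  \<comment> \<open>The kernel of one linear condition has codimension at most 1: if
    \<open>N\<close> spans the kernel inside \<open>U\<close>, one vector \<open>u\<close> off the
    kernel completes it to all of \<open>U\<close>. Two such steps would span \<open>V\<close> by
    six vectors.\<close>
  have step: "\<exists>u. \<forall>v\<in>U. v \<in> fv.span (insert u N)"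
    if U: "fv.subspace U" and N: "\<forall>v\<in>U. ip v x = 0 \<longrightarrow> v \<in> fv.span N" for U x N
  proof (cases "\<forall>v\<in>U. ip v x = 0")
    case True
    with N show ?thesis by (metis fv.span_mono subset_insertI subsetD)
  next
    case False
    then obtain u where u: "u \<in> U" "ip u x \<noteq> 0" by blast
    have "v \<in> fv.span (insert u N)" if "v \<in> U" for v
    proof -
      have "v - sc (ip v x / ip u x) u \<in> U" using U u that by (simp add: fv.subspace_diff fv.subspace_scale)
      moreover have "ip (v - sc (ip v x / ip u x) u) x = 0" using u by (simp add: ip_simps)
      ultimately show ?thesis using N fv.span_breakdown_eq by blast
    qed
    then show ?thesis by blast
  qed
  have "\<exists>r\<in>V. ip r x = 0 \<and> ip r y = 0 \<and> r \<notin> fv.span N"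
  proof (rule ccontr)
    assume contra: "\<not> ?thesis"
    have "fv.subspace {v \<in> V. ip v x = 0}"
      using subspace_V by (auto simp: fv.subspace_def ip_simps)
    from step[OF this, of y N] contra obtain u where "\<forall>v\<in>V. ip v x
        = 0 \<longrightarrow> v \<in> fv.span (insert u N)" by auto
    from step[OF subspace_V this] obtain u' where "V \<subseteq> fv.span (insert u' (insert u N))" by auto
    with assms(1) have "7 \<le> card (insert u' (insert u N))" by (intro span_card_ge) auto
    also have "\<dots> \<le> Suc (Suc (card N))" using assms(1) by (simp add: card_insert_if)
    finally show False using assms(2) by simp
  qed
  with that show thesis by blast
qed

section \<open>Vanishing products and products inside their own plane\<close>

lemma cr_eq_0_isotropic:
  assumes V: "x \<in> V" "y \<in> V" and xy: "x \<otimes> y = 0" and li: "x \<noteq> 0" "y \<notin> fv.span {x}"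
  shows "ip x x = 0" "ip x y = 0" "ip y y = 0"
proof -
  have "0 = sc (- ip x x) y + sc (ip x y) x" using cr_cr[OF V] xy by (simp add: cr_simps)
  then have e: "sc (ip x x) y = sc (ip x y) x" by (simp add: fun_eq_iff sc_def)
  show 1: "ip x x = 0"
  proof (rule ccontr)
    assume "ip x x \<noteq> 0"
    moreover have "sc (ip x x) y \<in> fv.span {x}" unfolding e in_span_1 by blast
    ultimately show False using scale_in_span_cancel li(2) by metis
  qed
  show 2: "ip x y = 0" using e 1 li(1) by simp
  have "y \<otimes> x = 0" using xy by (rule cr_eq_0_sym)
  then have "0 = sc (- ip y y) x + sc (ip y x) y" using cr_cr[OF V(2,1)] by (simp add: cr_simps)
  then show "ip y y = 0" using 2 li(1) by (simp add: ip_sym[of y x])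
qed

text \<open>With \<open>p\<close> dual to \<open>a\<close> and orthogonal to \<open>b, c\<close>, multiplication by \<open>a\<close> shows that
  \<open>a, b, c, p \<otimes> b, p \<otimes> c\<close> are independent; all five are orthogonal to \<open>a, b, c\<close>, and \<open>5 + 3 > 7\<close>.\<close>
lemma no_null_triple:
  assumes V: "a \<in> V" "b \<in> V" "c \<in> V"
    and cr: "a \<otimes> b = 0" "a \<otimes> c = 0" "b \<otimes> c = 0"
    and li: "a \<noteq> 0" "b \<notin> fv.span {a}" "c \<notin> fv.span {b, a}"
  shows False
proof -
  have c_a: "c \<notin> fv.span {a}" using li(3) fv.span_mono[of "{a}" "{b, a}"] by blast
  have c_b: "c \<notin> fv.span {b}" using li(3) fv.span_mono[of "{b}" "{b, a}"] by blast
  have b0: "b \<noteq> 0" using li(2) fv.span_zero by metis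
  have ip: "ip a a = 0" "ip b b = 0" "ip c c = 0" "ip a b = 0" "ip a c = 0" "ip b c = 0"
    using cr_eq_0_isotropic[OF V(1,2) cr(1) li(1,2)] cr_eq_0_isotropic[OF V(1,3) cr(2) li(1) c_a]
      cr_eq_0_isotropic[OF V(2,3) cr(3) b0 c_b] by auto
  have ip': "ip b a = 0" "ip c a = 0" "ip c b = 0" using ip ip_sym by metis+
  have cr': "b \<otimes> a = 0" "c \<otimes> a = 0" "c \<otimes> b = 0" using cr cr_eq_0_sym by blast+
  note ind = independent_3[OF li]
  have ne: "b \<noteq> a" "c \<noteq> a" using li(2) c_a fv.span_base[of a "{a}"] by auto
  obtain p where p: "p \<in> V" "ip p a = 1" "ip p b = 0" "ip p c = 0"
    using riesz_independent[OF ind(1), of "\<lambda>k. if k = a then 1 else 0"] V ne by auto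
  define q where "q = p \<otimes> b"
  define r where "r = p \<otimes> c"
  have q: "q \<in> V" "ip q a = 0" "ip q b = 0" "ip q c = 0"
    using cr cr' by (auto simp: q_def ip_cr ip_zero_right cr_self)
  have r: "r \<in> V" "ip r a = 0" "ip r b = 0" "ip r c = 0"
    using cr cr' by (auto simp: r_def ip_cr ip_zero_right cr_self)
  have aq: "a \<otimes> q = sc (- 2) b"
    using cr_cr_linear[OF V(1) p(1) V(2)] cr ip p by (simp add: q_def cr_zero_right ip_sym[of a p])
  have ar: "a \<otimes> r = sc (- 2) c"
    using cr_cr_linear[OF V(1) p(1) V(3)] cr ip p by (simp add: r_def cr_zero_right ip_sym[of a p])
  have q_span: "q \<notin> fv.span {c, b, a}"
  proof
    assume "q \<in> fv.span {c, b, a}"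
    then obtain s t u where "q = sc s c + sc t b + sc u a" unfolding in_span_3 by blast
    then have "a \<otimes> q = 0" using cr by (simp add: cr_simps)
    with aq b0 two show False by simp
  qed
  have r_span: "r \<notin> fv.span {q, c, b, a}"
  proof
    assume "r \<in> fv.span {q, c, b, a}"
    then obtain k where "r - sc k q \<in> fv.span {c, b, a}" using fv.span_breakdown_eq by blast
    then obtain s t u where "r - sc k q = sc s c + sc t b + sc u a" unfolding in_span_3 by blast
    then have "a \<otimes> (r - sc k q) = 0" using cr by (simp add: cr_simps)
    then have "sc (- 2) c = sc (- 2) (sc k b)" by (simp add: cr_simps aq ar mult.commute)
    then have "c = sc k b" using two by (subst (asm) fv.scale_cancel_left) simp
    with c_b show False unfolding in_span_1 by blast
  qed
  have "fv.independent {q, c, b, a}" "card {q, c, b, a} = 4"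
    using independent_insert_card[OF ind(1) _ q_span] ind(2) by auto
  then have "fv.independent {r, q, c, b, a}" "card {r, q, c, b, a} = 5"
    using independent_insert_card[of "{q, c, b, a}" r] r_span by auto
  moreover have "ip k l = 0" if "k \<in> {c, b, a}" "l \<in> {r, q, c, b, a}" for k l
    using that ip ip' q r ip_sym[of k l] by auto
  ultimately have "card {c, b, a} + card {r, q, c, b, a} \<le> 7"
    using ind(1) V q r by (intro orthogonal_card_le) auto
  with ind(2) \<open>card {r, q, c, b, a} = 5\<close> show False by simp
qed

text \<open>Inside the plane, \<open>x \<otimes> y\<close> is orthogonal to itself, being orthogonal
  to \<open>x\<close> and \<open>y\<close>; \<open>norm_cr\<close> turns this into a vanishing Gram
  determinant.\<close>

lemma cr_in_span_degenerate:
  assumes "x \<in> V" "y \<in> V" "x \<otimes> y \<in> fv.span {x, y}"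
  shows "ip x x * ip y y = ip x y * ip x y"
proof -
  obtain s t where w: "x \<otimes> y = sc s x + sc t y" using assms(3) in_span_2 by blast
  have "ip (x \<otimes> y) (x \<otimes> y) = ip (sc s x + sc t y) (x \<otimes> y)" by (simp only: w)
  also have "\<dots> = 0" by (simp add: ip_simps)
  finally show ?thesis by (simp add: norm_cr assms)
qed

text \<open>For radical \<open>x\<close>, multiplying twice by \<open>x\<close> kills
  \<open>y\<close>; applied to \<open>x \<otimes> y = s x + t y\<close> this leaves
  \<open>t (x \<otimes> y) = 0\<close>.\<close>

lemma cr_in_span_radical:
  assumes V: "x \<in> V" "y \<in> V" and w: "x \<otimes> y \<in> fv.span {x, y}" and ip: "ip x x = 0" "ip x y = 0"
  shows "\<exists>s. x \<otimes> y = sc s x"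
proof -
  obtain s t where st: "x \<otimes> y = sc s x + sc t y" using w in_span_2 by blast
  have "x \<otimes> (x \<otimes> y) = 0" using cr_cr[OF V] ip by simp
  moreover have "x \<otimes> (x \<otimes> y) = x \<otimes> (sc s x + sc t y)" by (simp only: st)
  ultimately have "sc t (x \<otimes> y) = 0" by (simp add: cr_simps)
  then have "t = 0 \<or> x \<otimes> y = 0" by simp
  then show ?thesis
  proof
    assume "t = 0" then show ?thesis using st by auto
  next
    assume "x \<otimes> y = 0" then show ?thesis by (intro exI[of _ 0]) simp
  qed
qed

text \<open>Both vectors are radical, so the product is a multiple of each of two independent
  vectors.\<close>

lemma cr_in_span_isotropic:
  assumes V: "x \<in> V" "y \<in> V" and w: "x \<otimes> y \<in> fv.span {x, y}"
    and ip: "ip x x = 0" "ip x y = 0" "ip y y = 0" and li: "y \<notin> fv.span {x}"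
  shows "x \<otimes> y = 0"
proof -
  obtain s where s: "x \<otimes> y = sc s x" using cr_in_span_radical[OF V w] ip by blast
  have "y \<otimes> x \<in> fv.span {y, x}" using w by (simp add: cr_skew[of y x] fv.span_neg insert_commute)
  then obtain t where t: "y \<otimes> x = sc t y" using cr_in_span_radical[OF V(2,1)] ip ip_sym by metis
  have e: "sc t y = sc (- s) x" using s t cr_skew[of y x] by simp
  have "t = 0"
  proof (rule ccontr)
    assume "t \<noteq> 0"
    moreover have "sc t y \<in> fv.span {x}" unfolding e in_span_1 by blast
    ultimately show False using scale_in_span_cancel li by metis
  qed
  then show ?thesis using t cr_eq_0_sym[of y x] by simp
qed

text \<open>For \<open>q = p \<otimes> z\<close> the associators \<open>asc x y q\<close> and
  \<open>asc x q y\<close> come out equal although they are opposite; their vanishing makes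
  \<open>s z\<close> a multiple of \<open>x\<close>.\<close>

lemma no_common_eigenvectors:
  assumes V: "x \<in> V" "y \<in> V" "z \<in> V"
    and cr: "x \<otimes> z = 0" "x \<otimes> y = sc s x" "z \<otimes> y = sc s z"
    and li: "x \<noteq> 0" "z \<notin> fv.span {x}"
  shows "s = 0"
proof (rule ccontr)
  assume s: "s \<noteq> 0"
  note iso = cr_eq_0_isotropic[OF V(1,3) cr(1) li]
  have "s * ip x y = ip (x \<otimes> y) y" by (simp only: cr(2) ip_sc_left)
  then have xy: "ip x y = 0" using s by simp
  have ne: "z \<noteq> x" using li(2) fv.span_base[of x "{x}"] by auto
  \<comment> \<open>These values of \<open>ip\<close> turn
    \<open>x \<otimes> (p \<otimes> z)\<close> into \<open>- 2 z\<close> by polarisation.\<close>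
  obtain p where p: "p \<in> V" "ip p x = 1" "ip p z = 0"
    using riesz_independent[OF independent_2(1)[OF li], of "\<lambda>k. if k = x then 1 else 0"] V ne by auto
  define q where "q = p \<otimes> z"
  have xq: "x \<otimes> q = sc (- 2) z"
    using cr_cr_linear[OF V(1) p(1) V(3)] cr iso p by (simp add: q_def cr_zero_right ip_sym[of x p])
  have "ip q x = 0" using cr(1) cr_eq_0_sym[of x z] by (simp add: q_def ip_cr ip_zero_right)
  then have "ip x q = 0" using ip_sym by metis
  then have 1: "asc x y q = sc s (sc (- 2) z) + sc (ip y q) x"
    by (simp add: asc_def cr cr_simps xq)
  have 2: "asc x q y = sc (- 2) (sc s z) + sc (ip y q) x"
    by (simp add: asc_def xq cr_simps cr(3) xy ip_sym[of q y])
  have "asc x q y = - asc x y q" using V by (intro asc_skew_23) (auto simp: q_def)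
  then have eq: "sc (- 2) (sc s z) + sc (ip y q) x = - (sc s (sc (- 2) z) + sc (ip y q) x)"
    unfolding 1 2 .
  have e: "sc (2 * s) z = sc (ip y q) x"
  proof
    fix i
    have "2 * (ip y q * x i) = 2 * (2 * s * z i)"
      using fun_cong[OF eq, of i] by (simp add: sc_def algebra_simps)
    then show "sc (2 * s) z i = sc (ip y q) x i"
      using two by (simp only: mult_cancel_left sc_def) simp
  qed
  have "sc (2 * s) z \<in> fv.span {x}" unfolding e in_span_1 by blast
  moreover have "2 * s \<noteq> 0" using s two by simp
  ultimately show False using li(2) scale_in_span_cancel by metis
qed

section \<open>Good pairs in three-dimensional subspaces\<close>

lemma exists_not_in_span:
  assumes "ldim S = 3" "finite N" "card N < 3"
  obtains v where "v \<in> S" "v \<notin> fv.span N"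
proof -
  have "\<not> S \<subseteq> fv.span N"
  proof
    assume "S \<subseteq> fv.span N"
    then have "ldim S \<le> card N" using assms(2) by (rule fv.dim_le_card)
    with assms show False by simp
  qed
  with that show thesis by blast
qed

text \<open>Otherwise the form degenerates on every plane of \<open>S\<close>, so its rank on
  \<open>S\<close> is at most 1. Rank 0 yields three independent vectors with vanishing products. In
  rank 1, an anisotropic \<open>y\<close> multiplies its complement in \<open>S\<close> by a scalar;
  that scalar must be 0, which contradicts \<open>cr_cr\<close> for \<open>y\<close>.\<close>

lemma exists_cr_not_in_span:
  assumes S: "lsubspace S" "S \<subseteq> V" "ldim S = 3"
  shows "\<exists>x\<in>S. \<exists>y\<in>S. x \<otimes> y \<notin> fv.span {x, y}"
proof (rule ccontr)
  assume "\<not> ?thesis"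
  then have H: "x \<otimes> y \<in> fv.span {x, y}" if "x \<in> S" "y \<in> S" for x y using that by blast
  note Sc = fv.subspace_add[OF S(1)] fv.subspace_scale[OF S(1)] fv.subspace_diff[OF S(1)]
  have deg: "ip x x * ip y y = ip x y * ip x y" if "x \<in> S" "y \<in> S" for x y
    using that H S(2) by (intro cr_in_span_degenerate) auto
  have null: "x \<otimes> y = 0" if "x \<in> S" "y \<in> S" "ip x x = 0" "ip y y = 0" "y \<notin> fv.span {x}" for x y
    using that H S(2) deg[of x y] by (intro cr_in_span_isotropic) auto
  show False
  proof (cases "\<forall>x\<in>S. ip x x = 0")
    case True
    obtain a where a: "a \<in> S" "a \<notin> fv.span {}" using exists_not_in_span[OF S(3), of "{}"] by auto
    obtain b where b: "b \<in> S" "b \<notin> fv.span {a}" using exists_not_in_span[OF S(3), of "{a}"] by auto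
    have "card {b, a} < 3" by (simp add: card_insert_if)
    then obtain c where c: "c \<in> S" "c \<notin> fv.span {b, a}"
        using exists_not_in_span[OF S(3), of "{b, a}"] by auto
    have "c \<notin> fv.span {a}" "c \<notin> fv.span {b}"
      using c(2) fv.span_mono[of "{a}" "{b, a}"] fv.span_mono[of "{b}" "{b, a}"] by blast+
    then show False
      using no_null_triple[of a b c] a b c null True S(2) by auto
  next
    case False
    then obtain y where y: "y \<in> S" "ip y y \<noteq> 0" by blast
    \<comment> \<open>Orthogonal projection along \<open>y\<close>: its values \<open>x\<close> and
      \<open>z\<close> below span the complement of \<open>y\<close> in \<open>S\<close>.\<close>
    define pr where "pr u = u - sc (ip u y / ip y y) y" for u
    have pr: "pr u \<in> S" "ip (pr u) y = 0" if "u \<in> S" for u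
      using that y by (auto simp: pr_def Sc ip_simps)
    obtain u where u: "u \<in> S" "u \<notin> fv.span {y}" using exists_not_in_span[OF S(3), of "{y}"] by auto
    have "card {y, u} < 3" by (simp add: card_insert_if)
    then obtain v where v: "v \<in> S" "v \<notin> fv.span {y, u}"
        using exists_not_in_span[OF S(3), of "{y, u}"] by auto
    define x where "x = pr u"
    define z where "z = pr v"
    have x: "x \<in> S" "x \<in> V" "ip x y = 0" and z: "z \<in> S" "z \<in> V" "ip z y = 0"
      using pr u v S(2) by (auto simp: x_def z_def)
    have x0: "x \<noteq> 0"
      using u(2) by (auto simp: x_def pr_def in_span_1)
    have zx: "z \<notin> fv.span {x}"
    proof
      assume "z \<in> fv.span {x}"
      then obtain k where "z = sc k x" unfolding in_span_1 by blast
      then have "v = sc (ip v y / ip y y - k * (ip u y / ip y y)) y + sc k u"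
        unfolding x_def z_def pr_def by (simp add: fun_eq_iff sc_def algebra_simps)
      with v(2) show False unfolding in_span_2 by blast
    qed
    have iso: "ip t t = 0" if "t \<in> S" "ip t y = 0" for t using deg[OF that(1) y(1)] y(2) that(2) by simp
    have xz: "x \<otimes> z = 0" using x z iso zx by (intro null) auto
    have eig: "\<exists>s. t \<otimes> y = sc s t" if "t \<in> S" "ip t y = 0" for t
      using that y H iso S(2) by (intro cr_in_span_radical) auto
    obtain s where s: "x \<otimes> y = sc s x" using eig x by blast
    obtain s' where s': "z \<otimes> y = sc s' z" using eig z by blast
    \<comment> \<open>That \<open>x + z\<close> is an eigenvector too forces the eigenvalues of
      \<open>x\<close> and \<open>z\<close> to coincide.\<close>
    have "x + z \<in> S" "ip (x + z) y = 0" using x z by (auto simp: Sc ip_simps)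
    then obtain s'' where s'': "(x + z) \<otimes> y = sc s'' (x + z)" using eig by blast
    have "sc s x + sc s' z = sc s'' x + sc s'' z" using s'' by (simp add: cr_simps s s' fv.scale_right_distrib)
    then have e: "sc (s' - s'') z = sc (s'' - s) x" by (simp add: fun_eq_iff sc_def algebra_simps)
    have s1: "s' = s''"
    proof (rule ccontr)
      assume "s' \<noteq> s''"
      then have "s' - s'' \<noteq> 0" by simp
      moreover have "sc (s' - s'') z \<in> fv.span {x}" unfolding e in_span_1 by blast
      ultimately show False using scale_in_span_cancel zx by metis
    qed
    then have s2: "s'' = s" using e x0 by simp
    have "s = 0"
      using no_common_eigenvectors[OF x(2) _ z(2) xz s] s' s1 s2 x0 zx y S(2) by auto
    then have "x \<otimes> y = 0" using s by simp
    then have "y \<otimes> x = 0" by (rule cr_eq_0_sym)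
    then have "0 = sc (- ip y y) x + sc (ip y x) y" using cr_cr[of y x] x y S(2) by (auto simp: cr_simps)
    then show False using y x0 x(3) by (simp add: ip_sym[of y x])
  qed
qed

section \<open>Solutions \<open>z\<close> of \<open>asc x y z = 0\<close> for a good pair\<close>

text \<open>An isotropic \<open>y\<close> is already radical, and swapping gives
  \<open>c = - 1\<close>; otherwise the component of \<open>x\<close> orthogonal to
  \<open>y\<close>, cleared of its denominator, is radical and \<open>c = ip y y\<close>. The scalar
  \<open>c\<close> is the determinant of the change of basis, hence the common factor of
  \<open>\<otimes>\<close> and \<open>asc\<close>.\<close>

lemma degenerate_basis:
  assumes V: "x \<in> V" "y \<in> V" and deg: "ip x x * ip y y = ip x y * ip x y"
    and li: "x \<noteq> 0" "y \<notin> fv.span {x}"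
  shows "\<exists>x'\<in>V. \<exists>y'\<in>V. \<exists>c. x' \<noteq> 0 \<and> ip x' x' = 0 \<and> ip x' y' = 0
      \<and> c \<noteq> 0 \<and> x' \<otimes> y' = sc c (x \<otimes> y)
    \<and> (\<forall>z. asc x' y' z = sc c (asc x y z)) \<and> x' \<in> fv.span {x, y} \<and> y' \<in> fv.span {x, y}
    \<and> x \<in> fv.span {x', y'} \<and> y \<in> fv.span {x', y'} \<and> y' \<notin> fv.span {x'}"
proof (cases "ip y y = 0")
  case True
  then have "ip x y = 0" using deg by simp
  moreover have "x \<notin> fv.span {y}"
  proof
    assume "x \<in> fv.span {y}"
    then obtain k where k: "x = sc k y" unfolding in_span_1 by blast
    with li(1) have "k \<noteq> 0" by auto
    moreover have "sc k y \<in> fv.span {x}" using k fv.span_base[of x "{x}"] by simp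
    ultimately show False using scale_in_span_cancel li(2) by metis
  qed
  moreover have "y \<noteq> 0" using li(2) fv.span_zero by metis
  moreover have "y \<otimes> x = sc (- 1) (x \<otimes> y)" by (simp add: cr_skew[of y x])
  moreover have "asc y x z = sc (- 1) (asc x y z)" for z by (simp add: asc_skew_12[of y x])
  ultimately show ?thesis using True V
    by (intro bexI[of _ y] bexI[of _ x] exI[of _ "- 1"]) (auto simp: ip_sym[of y x] fv.span_base)
next
  case False
  define x' where "x' = sc (ip y y) x - sc (ip x y) y"
  have "ip x' x' = ip y y * (ip x x * ip y y - ip x y * ip x y)"
    by (simp add: x'_def ip_simps ip_sym[of y x] algebra_simps)
  then have "ip x' x' = 0" using deg by simp
  moreover have "ip x' y = 0" by (simp add: x'_def ip_simps)
  moreover have yx': "y \<notin> fv.span {x'}"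
  proof
    assume "y \<in> fv.span {x'}"
    then obtain k where k: "y = sc k x'" unfolding in_span_1 by blast
    then have "ip y y = ip y (sc k x')" by simp
    also have "\<dots> = 0" by (simp add: x'_def ip_simps ip_sym[of y x])
    finally show False using False by simp
  qed
  moreover have x: "sc (ip y y) x = x' + sc (ip x y) y" by (simp add: x'_def)
  moreover have "x' \<noteq> 0"
  proof
    assume "x' = 0"
    then have "y \<noteq> 0" "sc (ip y y) x = sc (ip x y) y" using x False by (auto simp: ip_simps)
    then have "x = sc (inverse (ip y y) * ip x y) y" using False by (metis fv.scale_scale fv.scale_one left_inverse)
    then obtain k where k: "x = sc k y" by blast
    with li(1) have "k \<noteq> 0" by auto
    moreover have "sc k y \<in> fv.span {x}" using k fv.span_base[of x "{x}"] by simp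
    ultimately show False using scale_in_span_cancel li(2) by metis
  qed
  moreover have "x' \<otimes> y = sc (ip y y) (x \<otimes> y)" by (simp add: x'_def cr_simps)
  moreover have "asc x' y z = sc (ip y y) (asc x y z)" for z
  proof -
    have "sc (ip y y) (asc x y z) = asc (x' + sc (ip x y) y) y z" by (simp only: asc_sc flip: x)
    then show ?thesis by (simp add: asc_add asc_sc)
  qed
  moreover have "x' \<in> fv.span {x, y}"
    unfolding x'_def by (intro fv.span_diff fv.span_scale fv.span_base) auto
  moreover have "sc (ip y y) x \<in> fv.span {x', y}"
    unfolding x by (intro fv.span_add fv.span_scale fv.span_base) auto
  then have "x \<in> fv.span {x', y}" using False scale_in_span_cancel by blast
  moreover have "y \<in> fv.span {x, y}" "y \<in> fv.span {x', y}" by (auto intro: fv.span_base)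
  moreover have "x' \<in> V" using V by (simp add: x'_def)
  ultimately show ?thesis using False V(2) by blast
qed

text \<open>The rotated equations force \<open>ip w z = 0\<close> and \<open>ip x z = 0\<close> for
  \<open>w = x \<otimes> y\<close>. Then \<open>ip y y\<close> decides which obstruction arises: the
  isotropic 4-space if it vanishes, the triple with vanishing products otherwise.\<close>

lemma radical_nucleus_in_span:
  assumes V: "x \<in> V" "y \<in> V" "z \<in> V" and ip: "ip x x = 0" "ip x y = 0"
    and w: "x \<otimes> y \<notin> fv.span {x, y}" and asc: "asc x y z = 0"
  shows "z \<in> fv.span {x, y, x \<otimes> y}"
proof -
  define w where "w = x \<otimes> y"
  have wV: "w \<in> V" by (simp add: w_def)
  have w_span: "w \<notin> fv.span {x, y}" using w by (simp add: w_def)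
  have w_x: "w \<notin> fv.span {x}" using w_span fv.span_mono[of "{x}" "{x, y}"] by blast
  have w0: "w \<noteq> 0" using w_span fv.span_zero by metis
  have x0: "x \<noteq> 0" using w0 by (auto simp: w_def cr_simps)
  have y_x: "y \<notin> fv.span {x}" using w0 by (auto simp: w_def in_span_1 cr_simps)
  have xw: "x \<otimes> w = 0" using cr_cr[OF V(1,2)] ip by (simp add: w_def)
  have wx: "w \<otimes> x = 0" using xw by (rule cr_eq_0_sym)
  have wy: "w \<otimes> y = sc (- ip y y) x" using cr_cr_right[OF V(2,1)] ip by (simp add: w_def ip_sym[of y x])
  have ww: "ip w w = 0" using norm_cr[OF V(1,2)] ip by (simp add: w_def)
  have ipw: "ip w x = 0" "ip x w = 0" "ip w y = 0" "ip y w = 0" by (simp_all add: w_def)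
  define a b where "a = ip x z" and "b = ip y z"
  have asc': "asc y z x = 0" "asc z x y = 0" using asc_rotate[OF V] asc by auto
  have wz: "w \<otimes> z = sc a y - sc b x"
    using asc by (simp add: asc_def w_def a_def b_def algebra_simps add_eq_0_iff)
  \<comment> \<open>Two evaluations of one product: a multiple of \<open>w\<close> by
    \<open>cr_cr\<close>, a multiple of \<open>x\<close> by the formula for
    \<open>w \<otimes> z\<close>.\<close>
  have "w \<otimes> (w \<otimes> z) = sc (ip w z) w" using cr_cr[OF wV V(3)] ww by simp
  moreover have "w \<otimes> (w \<otimes> z) = sc (- (a * ip y y)) x" unfolding wz by (simp add: cr_simps wx wy)
  ultimately have e: "sc (ip w z) w = sc (- (a * ip y y)) x" by simp
  have wz0: "ip w z = 0"
  proof (rule ccontr)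
    assume "ip w z \<noteq> 0"
    moreover have "sc (ip w z) w \<in> fv.span {x}" unfolding e in_span_1 by blast
    ultimately show False using scale_in_span_cancel w_x by metis
  qed
  \<comment> \<open>The same comparison for
    \<open>x \<otimes> (x \<otimes> (y \<otimes> z))\<close>, starting from a rotated
    associator.\<close>
  have a0: "a = 0"
  proof -
    have "(y \<otimes> z) \<otimes> x = - sc a y"
      using asc'(1) ip by (simp add: asc_def a_def ip_sym[of z x] ip_sym[of y x] add_eq_0_iff)
    then have "x \<otimes> (y \<otimes> z) = sc a y" by (simp add: cr_skew[of x])
    then have "x \<otimes> (x \<otimes> (y \<otimes> z)) = sc a w" by (simp add: w_def cr_simps)
    moreover have "x \<otimes> (x \<otimes> (y \<otimes> z)) = sc (ip w z) x"
        using cr_cr[of x "y \<otimes> z"] V ip by (simp add: w_def ip_cr)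
    ultimately show ?thesis using wz0 w0 by simp
  qed
  have zxy: "(z \<otimes> x) \<otimes> y = sc b x"
    using asc'(2) a0 ip by (simp add: asc_def a_def b_def ip_sym[of z y] algebra_simps)
  have ipzx: "ip (z \<otimes> x) y = 0" using wz0 by (simp add: ip_cr w_def ip_sym[of z])
  show ?thesis
  proof (cases "ip y y = 0")
    case True
    have "((z \<otimes> x) \<otimes> y) \<otimes> y = 0"
      using cr_cr_right[of y "z \<otimes> x"] V True ipzx by (simp add: ip_sym[of y "z \<otimes> x"])
    then have "sc b w = 0" unfolding zxy by (simp add: w_def cr_simps)
    then have b0: "b = 0" using w0 by simp
    have wz': "w \<otimes> z = 0" using wz a0 b0 by simp
    show ?thesis
    proof (rule ccontr)
      assume "\<not> ?thesis"
      then have z: "z \<notin> fv.span {w, y, x}" by (simp add: w_def insert_commute)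
      then have z_w: "z \<notin> fv.span {w}" using fv.span_mono[of "{w}" "{w, y, x}"] by blast
      have zz: "ip z z = 0" using cr_eq_0_isotropic[OF wV V(3) wz' w0 z_w] by simp
      have "w \<notin> fv.span {y, x}" using w_span by (simp add: insert_commute)
      note ind = independent_3[OF x0 y_x this]
      have ind4: "fv.independent {z, w, y, x}" "card {z, w, y, x} = 4"
        using independent_insert_card[OF ind(1) _ z] ind(2) by auto
      have "ip k l = 0" if "k \<in> {z, w, y, x}" "l \<in> {z, w, y, x}" for k l
        using that ip True ww ipw zz wz0 a0 b0 ip_sym[of k l] ip_sym[of l k] by (auto simp: a_def b_def)
      then have "card {z, w, y, x} + card {z, w, y, x} \<le> 7"
        using V wV by (intro orthogonal_card_le ind4(1)) auto
      with ind4(2) show False by simp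
    qed
  next
    case False
    \<comment> \<open>The correction that makes \<open>z\<close> orthogonal to \<open>y\<close> also
      cancels \<open>w \<otimes> z\<close>, because
      \<open>w \<otimes> y = - (ip y y) x\<close>.\<close>
    define z' where "z' = z - sc (b / ip y y) y"
    have z'V: "z' \<in> V" using V by (simp add: z'_def)
    have ipz': "ip x z' = 0" "ip y z' = 0" using a0 ip False by (auto simp: z'_def ip_simps a_def b_def)
    have "w \<otimes> z' = 0" unfolding z'_def using wz a0 False by (simp add: cr_simps wy)
    have z: "z = z' + sc (b / ip y y) y" by (simp add: z'_def)
    have "(z' \<otimes> x) \<otimes> y = (z \<otimes> x) \<otimes> y - sc (b / ip y y) ((y \<otimes> x) \<otimes> y)"
      by (simp add: z'_def cr_simps)
    also have "(y \<otimes> x) \<otimes> y = - (w \<otimes> y)" by (simp add: w_def cr_skew[of y x] cr_simps)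
    also have "(z \<otimes> x) \<otimes> y - sc (b / ip y y) (- (w \<otimes> y)) = 0"
      using False by (simp add: zxy wy fun_eq_iff sc_def)
    finally have "((z' \<otimes> x) \<otimes> y) \<otimes> y = 0" by (simp add: cr_simps)
    moreover have "ip y (z' \<otimes> x) = 0"
      using ipzx by (simp add: z'_def cr_simps ip_simps ip_sym[of y "z \<otimes> x"])
    ultimately have "sc (- ip y y) (z' \<otimes> x) = 0"
      using cr_cr_right[of y "z' \<otimes> x"] V by simp
    then have z'x: "z' \<otimes> x = 0" using False by simp
    have "z' \<in> fv.span {w, x}"
      using no_null_triple[OF V(1) wV z'V xw cr_eq_0_sym[OF z'x] \<open>w \<otimes> z' = 0\<close> x0 w_x] by blast
    then have "z' \<in> fv.span {x, y, w}" using fv.span_mono[of "{w, x}" "{x, y, w}"] by blast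
    then show ?thesis
      unfolding z w_def[symmetric] by (intro fv.span_add fv.span_scale) (auto intro: fv.span_base)
  qed
qed

text \<open>On a nondegenerate plane \<open>asc x y z = 0\<close> puts \<open>w \<otimes> z\<close>
  into the plane, and multiplication by \<open>w\<close> maps the plane into the span of
  \<open>x\<close>, \<open>y\<close>, \<open>w\<close>. So
  \<open>w \<otimes> (w \<otimes> z)\<close> lies there, and by \<open>cr_cr\<close> it is a nonzero
  multiple of \<open>z\<close> up to a multiple of \<open>w\<close>.\<close>

lemma nucleus_in_span:
  assumes V: "x \<in> V" "y \<in> V" "z \<in> V"
    and w: "x \<otimes> y \<notin> fv.span {x, y}" and asc: "asc x y z = 0"
  shows "z \<in> fv.span {x, y, x \<otimes> y}"
proof (cases "ip x x * ip y y = ip x y * ip x y")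
  case True
  have w0: "x \<otimes> y \<noteq> 0" using w fv.span_zero by metis
  have x0: "x \<noteq> 0" using w0 by (auto simp: cr_simps)
  have y_x: "y \<notin> fv.span {x}" using w0 by (auto simp: in_span_1 cr_simps)
  obtain x' y' c where b: "x' \<in> V" "y' \<in> V" "ip x' x' = 0" "ip x' y' = 0" "c \<noteq> 0"
      "x' \<otimes> y' = sc c (x \<otimes> y)" "asc x' y' z = sc c (asc x y z)"
      "x' \<in> fv.span {x, y}" "y' \<in> fv.span {x, y}"
    using degenerate_basis[OF V(1,2) True x0 y_x] by blast
  have sub: "fv.span {x', y'} \<subseteq> fv.span {x, y}" using b by (intro fv.span_minimal) auto
  have "x' \<otimes> y' \<notin> fv.span {x', y'}"
  proof
    assume "x' \<otimes> y' \<in> fv.span {x', y'}"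
    then have "sc c (x \<otimes> y) \<in> fv.span {x, y}" using sub b(6) by auto
    with w b(5) scale_in_span_cancel show False by metis
  qed
  then have "z \<in> fv.span {x', y', x' \<otimes> y'}" using b asc V by (intro radical_nucleus_in_span) auto
  moreover have "fv.span {x, y} \<subseteq> fv.span {x, y, x \<otimes> y}" by (intro fv.span_mono) auto
  then have "fv.span {x', y', x' \<otimes> y'} \<subseteq> fv.span {x, y, x \<otimes> y}"
    using b by (intro fv.span_minimal) (auto intro: fv.span_scale fv.span_base)
  ultimately show ?thesis by blast
next
  case False
  define w where "w = x \<otimes> y"
  have wz: "w \<otimes> z = sc (ip x z) y - sc (ip y z) x"
    using asc by (simp add: asc_def w_def algebra_simps add_eq_0_iff)
  have span: "x \<in> fv.span {x, y, w}" "y \<in> fv.span {x, y, w}" "w \<in> fv.span {x, y, w}"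
    by (auto intro: fv.span_base)
  have "w \<otimes> y \<in> fv.span {x, y, w}"
    unfolding w_def cr_cr_right[OF V(2,1)] using span by (intro fv.span_add fv.span_scale) (auto simp: w_def)
  moreover have "w \<otimes> x = - ((y \<otimes> x) \<otimes> x)" by (simp add: w_def cr_skew[of y x] cr_simps)
  then have "w \<otimes> x \<in> fv.span {x, y, w}"
    using span by (auto simp: cr_cr_right[OF V(1,2)] intro!: fv.span_add fv.span_scale fv.span_diff)
  ultimately have "w \<otimes> (w \<otimes> z) \<in> fv.span {x, y, w}"
    unfolding wz by (simp add: cr_simps fv.span_diff fv.span_scale)
  moreover have "w \<otimes> (w \<otimes> z) = sc (- ip w w) z + sc (ip w z) w" using V
      by (intro cr_cr) (auto simp: w_def)
  ultimately have "sc (- ip w w) z + sc (ip w z) w - sc (ip w z) w \<in> fv.span {x, y, w}"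
    using span by (intro fv.span_diff fv.span_scale) auto
  then have "sc (- ip w w) z \<in> fv.span {x, y, w}" by simp
  moreover have "- ip w w \<noteq> 0" using False norm_cr[OF V(1,2)] by (simp add: w_def)
  ultimately show ?thesis unfolding w_def[symmetric] by (rule scale_in_span_cancel)
qed

section \<open>Annihilators of isotropic vectors and associative triples over a given plane\<close>

text \<open>For \<open>r\<close> orthogonal to \<open>x\<close>, the product
  \<open>x \<otimes> r\<close> is annihilated by \<open>x\<close>. If it is only a multiple of
  \<open>x\<close>, then \<open>r\<close> and \<open>y\<close> both go to multiples of
  \<open>x\<close>, and a combination of them is killed.\<close>

lemma eigen_annihilator:
  assumes V: "x \<in> V" "y \<in> V" and x: "x \<noteq> 0" "ip x x = 0" and eig: "x \<otimes> y
      = sc s x" "s \<noteq> 0"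
  shows "\<exists>z\<in>V. z \<notin> fv.span {x} \<and> x \<otimes> z = 0"
proof -
  have "finite {x, y}" "card {x, y} \<le> 4" by (auto simp: card_insert_if)
  then obtain r where r: "r \<in> V" "ip r x = 0" "r \<notin> fv.span {x, y}" by (rule orthogonal_not_in_span)
  have xxr: "x \<otimes> (x \<otimes> r) = 0" using cr_cr[OF V(1) r(1)] x r by (simp add: ip_sym[of x r])
  show ?thesis
  proof (cases "x \<otimes> r \<in> fv.span {x}")
    case False
    with xxr show ?thesis by blast
  next
    case True
    then obtain l where l: "x \<otimes> r = sc l x" unfolding in_span_1 by blast
    define z where "z = sc s r - sc l y"
    have "x \<otimes> z = 0" by (simp add: z_def cr_simps l eig mult.commute)
    moreover have "z \<notin> fv.span {x}"
    proof
      assume "z \<in> fv.span {x}"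
      then obtain k where "sc s r - sc l y = sc k x" unfolding in_span_1 z_def by blast
      then have "sc s r = sc k x + sc l y" by (simp add: diff_eq_eq)
      then have "sc s r \<in> fv.span {x, y}" unfolding in_span_2 by blast
      with r(3) eig(2) scale_in_span_cancel show False by metis
    qed
    ultimately show ?thesis using V r by (auto simp: z_def)
  qed
qed

text \<open>If \<open>ip p x = 1\<close>, then \<open>x \<otimes> (x \<otimes> p) = x\<close>, so
  \<open>x \<otimes> p\<close> is the \<open>y\<close> of \<open>eigen_annihilator\<close>.\<close>

lemma isotropic_annihilator:
  assumes V: "x \<in> V" and x: "x \<noteq> 0" "ip x x = 0"
  shows "\<exists>z\<in>V. z \<notin> fv.span {x} \<and> x \<otimes> z = 0"
proof -
  obtain p where p: "p \<in> V" "ip p x = 1"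
    using riesz_independent[OF independent_1[OF x(1)], of "\<lambda>_. 1"] V by auto
  have "x \<otimes> (x \<otimes> p) = sc 1 x" using cr_cr[OF V p(1)] x p by (simp add: ip_sym[of x p])
  then show ?thesis using V x by (intro eigen_annihilator[of x "x \<otimes> p" 1]) auto
qed

text \<open>Unless it lies in the plane, \<open>x \<otimes> y\<close> itself serves. Otherwise a
  radical basis has \<open>x' \<otimes> y' = s x'\<close>. For \<open>s = 0\<close> any vector
  orthogonal to the plane serves, as only the inner-product terms of \<open>asc\<close> remain; for
  other \<open>s\<close> a vector annihilated by \<open>x'\<close> does.\<close>

lemma exists_nucleus_outside:
  assumes V: "x \<in> V" "y \<in> V" and li: "x \<noteq> 0" "y \<notin> fv.span {x}"
  shows "\<exists>z\<in>V. z \<notin> fv.span {x, y} \<and> asc x y z = 0"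
proof (cases "x \<otimes> y \<in> fv.span {x, y}")
  case False
  then show ?thesis by (intro bexI[of _ "x \<otimes> y"]) auto
next
  case True
  obtain x' y' c where b: "x' \<in> V" "y' \<in> V" "x' \<noteq> 0" "ip x' x' = 0" "ip x' y' = 0" "c \<noteq> 0"
      "x' \<otimes> y' = sc c (x \<otimes> y)" "\<And>z. asc x' y' z = sc c (asc x y z)"
      "x \<in> fv.span {x', y'}" "y \<in> fv.span {x', y'}" "y' \<notin> fv.span {x'}"
    using degenerate_basis[OF V cr_in_span_degenerate[OF V True] li] by blast
  have sub: "fv.span {x, y} \<subseteq> fv.span {x', y'}" using b by (intro fv.span_minimal) auto
  have "x' \<otimes> y' \<in> fv.span {x', y'}" using b(7) True sub fv.span_scale by auto
  then obtain s where s: "x' \<otimes> y' = sc s x'" using cr_in_span_radical b by blast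
  have "\<exists>z\<in>V. z \<notin> fv.span {x', y'} \<and> asc x' y' z = 0"
  proof (cases "s = 0")
    case True
    have "finite {x', y'}" "card {x', y'} \<le> 4" by (auto simp: card_insert_if)
    then obtain r where r: "r \<in> V" "ip r x' = 0" "ip r y' = 0" "r \<notin> fv.span {x', y'}"
      by (rule orthogonal_not_in_span)
    then have "asc x' y' r = 0" by (simp add: asc_def s True cr_simps ip_sym[of _ r])
    with r show ?thesis by blast
  next
    case False
    obtain z where z: "z \<in> V" "z \<notin> fv.span {x'}" "x' \<otimes> z = 0"
      using eigen_annihilator[OF b(1,2,3,4) s False] by blast
    have xz: "ip x' z = 0" using cr_eq_0_isotropic[OF b(1) z(1,3) b(3) z(2)] by simp
    \<comment> \<open>Equal values in both orders, although skewness makes them opposite: hence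
      \<open>ip y' z = 0\<close>.\<close>
    have 1: "asc x' y' z = sc (ip y' z) x'" by (simp add: asc_def s cr_simps z(3) xz)
    have 2: "asc x' z y' = sc (ip y' z) x'" by (simp add: asc_def z(3) cr_simps b(5) ip_sym[of z y'])
    have "asc x' z y' = - asc x' y' z" using b z by (intro asc_skew_23) auto
    then have "sc (ip y' z) x' + sc (ip y' z) x' = 0" unfolding 1 2 by (simp only: eq_neg_iff_add_eq_0)
    then have "sc (2 * ip y' z) x' = 0" by (simp only: mult_2 fv.scale_left_distrib)
    then have "2 * ip y' z = 0" using b(3) by (simp only: fv.scale_eq_0_iff simp_thms)
    then have "asc x' y' z = 0" unfolding 1 using two by simp
    moreover have "z \<notin> fv.span {x', y'}"
    proof
      assume "z \<in> fv.span {x', y'}"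
      then obtain k l where kl: "z = sc k x' + sc l y'" unfolding in_span_2 by blast
      then have "sc (l * s) x' = 0" using z(3) by (simp add: cr_simps s)
      then have "l = 0" using False b(3) by simp
      with kl z(2) show False unfolding in_span_1 by auto
    qed
    ultimately show ?thesis using z by blast
  qed
  with sub b(6,8) show ?thesis by auto
qed

text \<open>When \<open>x \<otimes> z = 0\<close>, \<open>asc x z\<close> vanishes on the whole
  orthogonal complement of \<open>x\<close> and \<open>z\<close>. Its dimension is at least 5, which
  leaves room for two solutions that span different blocks.\<close>

lemma annihilating_pair_nucleus:
  assumes V: "x \<in> V" "z \<in> V" and xz: "x \<otimes> z = 0"
  shows "\<exists>u\<in>V. \<exists>v\<in>V. asc x z u = 0 \<and> asc x z v = 0 \<and> u \<notin> fv.span {x, z}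
      \<and> v \<notin> fv.span {x, z, u}"
proof -
  have "finite {x, z}" "card {x, z} \<le> 4" by (auto simp: card_insert_if)
  then obtain u where u: "u \<in> V" "ip u x = 0" "ip u z = 0" "u \<notin> fv.span {x, z}"
    by (rule orthogonal_not_in_span)
  have "finite {x, z, u}" "card {x, z, u} \<le> 4" by (auto simp: card_insert_if)
  then obtain v where v: "v \<in> V" "ip v x = 0" "ip v z = 0" "v \<notin> fv.span {x, z, u}"
    by (rule orthogonal_not_in_span)
  have "asc x z t = 0" if "ip t x = 0" "ip t z = 0" for t
    using that by (simp add: asc_def xz cr_simps ip_sym[of _ t])
  with u v show ?thesis by blast
qed

text \<open>The witness is \<open>(k + a) c\<close>, where \<open>k + a\<close> has norm \<open>k\<^sup>2 + ip a a = 0\<close> and \<open>c\<close> is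
  anisotropic and orthogonal to \<open>a\<close>, so that the product is again imaginary.\<close>
lemma exists_isotropic:
  assumes a: "a \<in> V" "ip a a = - (k * k)" "k \<noteq> 0"
  shows "\<exists>x\<in>V. x \<noteq> 0 \<and> ip x x = 0"
proof -
  have a0: "a \<noteq> 0" using a by (auto simp: ip_simps)
  obtain c where c: "c \<in> V" "ip c a = 0" "ip c c \<noteq> 0"
  proof -
    have "finite {a}" "card {a} \<le> 4" by auto
    then obtain r where r: "r \<in> V" "ip r a = 0" "r \<notin> fv.span {a}" by (rule orthogonal_not_in_span)
    have "r \<noteq> a" using r(3) fv.span_base[of a "{a}"] by auto
    then obtain d where d: "d \<in> V" "ip d a = 0" "ip d r = 1"
      using riesz_independent[OF independent_2(1)[OF a0 r(3)], of "\<lambda>k. if k = a then 0 else 1"] r a by auto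
    \<comment> \<open>If \<open>r\<close> and \<open>d\<close> are both isotropic, their sum has
      norm 2, so one of the three is anisotropic.\<close>
    have "ip (r + d) (r + d) = ip r r + 2 + ip d d" using d by (simp add: ip_simps ip_sym[of r d])
    then have "ip r r \<noteq> 0 \<or> ip d d \<noteq> 0 \<or> ip (r + d) (r + d) \<noteq> 0" using two by auto
    moreover have "r + d \<in> V" "ip (r + d) a = 0" using r d by (auto simp: ip_simps)
    ultimately show thesis using that r d by blast
  qed
  define x where "x = sc k c + a \<otimes> c"
  have "ip x x = k * k * ip c c + ip (a \<otimes> c) (a \<otimes> c)"
    by (simp add: x_def ip_simps algebra_simps)
  then have "ip x x = 0" using a c by (simp add: norm_cr ip_sym[of a c])
  moreover have "x \<noteq> 0"
  proof
    assume "x = 0"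
    have "c \<otimes> x = c \<otimes> (a \<otimes> c)" by (simp add: x_def cr_simps)
    also have "\<dots> = - (c \<otimes> (c \<otimes> a))" by (simp add: cr_skew[of a c] cr_simps)
    also have "\<dots> = sc (ip c c) a" using cr_cr[OF c(1) a(1)] c by simp
    finally show False using \<open>x = 0\<close> c a0 by (simp add: cr_simps)
  qed
  ultimately show ?thesis using a c by (intro bexI[of _ x]) (auto simp: x_def)
qed

section \<open>Blocks\<close>

text \<open>Alternation settles all triples of generators; trilinearity then extends this one
  argument at a time, from the last to the first.\<close>

lemma asc_eq_0_span:
  assumes V: "x \<in> V" "y \<in> V" "z \<in> V" and asc: "asc x y z = 0"
    and uvw: "u \<in> fv.span {x, y, z}" "v \<in> fv.span {x, y, z}" "w \<in> fv.span {x, y, z}"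
  shows "asc u v w = 0"
proof -
  have "asc y z x = 0" "asc z x y = 0" "asc y x z = 0" "asc x z y = 0"
    using asc_rotate[OF V] asc_skew_12[of y x z] asc_skew_23[OF V] asc by simp_all
  moreover from this(1) have "asc z y x = 0" using asc_skew_12[of z y x] by simp
  ultimately have perms: "asc y z x = 0" "asc z x y = 0" "asc y x z = 0" "asc x z y = 0" "asc z y x = 0" by blast+
  have "asc s t r = 0" if "s \<in> {x, y, z}" "t \<in> {x, y, z}" "r \<in> {x, y, z}" for s t r
    using that V by (auto simp: asc perms)
  note 1 = this
  obtain a b c where w: "w = sc a x + sc b y + sc c z" using uvw(3) unfolding in_span_3 by blast
  have 2: "asc s t w = 0" if "s \<in> {x, y, z}" "t \<in> {x, y, z}" for s t
    unfolding w asc_add asc_sc using 1[OF that] by simp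
  obtain a' b' c' where v: "v = sc a' x + sc b' y + sc c' z" using uvw(2) unfolding in_span_3 by blast
  have 3: "asc s v w = 0" if "s \<in> {x, y, z}" for s
    unfolding v asc_add asc_sc using 2[OF that] by simp
  obtain a'' b'' c'' where u: "u = sc a'' x + sc b'' y + sc c'' z" using uvw(1) unfolding in_span_3 by blast
  show ?thesis
    unfolding u asc_add asc_sc using 3 by simp
qed

definition block :: "(nat \<Rightarrow> 'f) set \<Rightarrow> bool" where
  "block S \<longleftrightarrow> lsubspace S \<and> S \<subseteq> V \<and> ldim S = 3
      \<and> (\<forall>x\<in>S. \<forall>y\<in>S. \<forall>z\<in>S. asc x y z = 0)"

lemma block_span:
  assumes V: "x \<in> V" "y \<in> V" "z \<in> V" and asc: "asc x y z = 0"
    and li: "x \<noteq> 0" "y \<notin> fv.span {x}" "z \<notin> fv.span {x, y}"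
  shows "block (fv.span {x, y, z})"
proof -
  have "z \<notin> fv.span {y, x}" using li(3) by (simp add: insert_commute)
  from independent_3[OF li(1,2) this] have "fv.independent {x, y, z}" "card {x, y, z} = 3"
    by (simp_all add: insert_commute)
  then have "ldim (fv.span {x, y, z}) = 3" by (simp add: fv.dim_eq_card_independent)
  moreover have "fv.span {x, y, z} \<subseteq> V" using V subspace_V by (intro fv.span_minimal) auto
  ultimately show ?thesis
    unfolding block_def using asc_eq_0_span[OF V asc] by auto
qed

text \<open>\<open>nucleus_in_span\<close> bounds \<open>S\<close> from above. Being of dimension 3,
  \<open>S\<close> leaves the plane, and a vector that does so has a nonzero coefficient at
  \<open>x \<otimes> y\<close>, which brings this product into \<open>S\<close>.\<close>

lemma block_eq_span:
  assumes S: "block S" and xy: "x \<in> S" "y \<in> S" and w: "x \<otimes> y \<notin> fv.span {x, y}"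
  shows "S = fv.span {x, y, x \<otimes> y}"
proof -
  have sub: "S \<subseteq> fv.span {x, y, x \<otimes> y}"
  proof
    fix z assume "z \<in> S"
    then show "z \<in> fv.span {x, y, x \<otimes> y}" using S xy w unfolding block_def by (intro nucleus_in_span) auto
  qed
  have Ss: "lsubspace S" "ldim S = 3" using S by (auto simp: block_def)
  have "card {x, y} < 3" by (simp add: card_insert_if)
  then obtain v where v: "v \<in> S" "v \<notin> fv.span {x, y}" using exists_not_in_span[OF Ss(2), of "{x, y}"]
      by auto
  have "v \<in> fv.span {x, y, x \<otimes> y}" using v(1) sub by (rule rev_subsetD)
  then obtain a b c where abc: "v = sc a x + sc b y + sc c (x \<otimes> y)" unfolding in_span_3 by blast
  have "c \<noteq> 0" using v(2) abc unfolding in_span_2 by (metis fv.scale_zero_left add_0_right)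
  have "v - sc a x - sc b y \<in> S" using v xy Ss by (intro fv.subspace_diff fv.subspace_scale) auto
  then have "sc c (x \<otimes> y) \<in> S" by (simp add: abc)
  then have "x \<otimes> y \<in> S"
      using fv.subspace_scale[OF Ss(1), of "sc c (x \<otimes> y)" "inverse c"] \<open>c \<noteq> 0\<close> by simp
  then have "fv.span {x, y, x \<otimes> y} \<subseteq> S" using xy Ss by (intro fv.span_minimal) auto
  with sub show ?thesis by blast
qed

lemma block_generators:
  assumes "block S"
  obtains x y where "x \<in> S" "y \<in> S" "x \<otimes> y \<notin> fv.span {x, y}"
  using exists_cr_not_in_span[of S] assms unfolding block_def by blast

lemma cr_not_in_span_independent:
  assumes "x \<otimes> y \<notin> fv.span {x, y}"
  shows "x \<noteq> 0" "y \<notin> fv.span {x}"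
proof -
  have w0: "x \<otimes> y \<noteq> 0" using assms fv.span_zero by metis
  then show "x \<noteq> 0" "y \<notin> fv.span {x}" by (auto simp: in_span_1 cr_simps)
qed

lemma dim_span_2: "x \<noteq> 0 \<Longrightarrow> y \<notin> fv.span {x} \<Longrightarrow> ldim (fv.span {x, y}) = 2"
  using independent_2[of x y] by (simp add: fv.dim_eq_card_independent insert_commute)

lemma plane_basis:
  assumes "lsubspace W" "ldim W = 2"
  obtains x y where "x \<in> W" "y \<in> W" "x \<noteq> 0" "y \<notin> fv.span {x}" "W = fv.span {x, y}"
proof -
  obtain b where b: "b \<subseteq> W" "fv.independent b" "W \<subseteq> fv.span b" "card b = 2"
    using fv.basis_exists[of W] assms(2) by metis
  from b(4) obtain x y where xy: "b = {x, y}" "x \<noteq> y" by (auto simp: card_2_iff)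
  have "fv.independent (insert y {x})" using b(2) xy by (simp add: insert_commute)
  then have "y \<notin> fv.span {x}" "fv.independent {x}" using xy(2) unfolding fv.independent_insert by auto
  moreover from this have "x \<noteq> 0" using fv.dependent_zero by blast
  moreover have "W = fv.span {x, y}" using b xy assms(1) by (metis fv.span_minimal subset_antisym)
  ultimately show thesis using that b(1) xy by blast
qed

lemma blocks_cover:
  assumes W: "lsubspace W" "W \<subseteq> V" "ldim W = 2"
  shows "\<exists>S. block S \<and> W \<subseteq> S"
proof -
  obtain x y where xy: "x \<in> W" "y \<in> W" "x \<noteq> 0" "y \<notin> fv.span {x}" "W = fv.span {x, y}"
    using plane_basis[OF W(1,3)] by blast
  have V: "x \<in> V" "y \<in> V" using xy W by auto
  obtain z where z: "z \<in> V" "z \<notin> fv.span {x, y}" "asc x y z = 0"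
    using exists_nucleus_outside[OF V xy(3,4)] by blast
  have "block (fv.span {x, y, z})" using block_span[OF V z(1,3) xy(3,4) z(2)] .
  moreover have "W \<subseteq> fv.span {x, y, z}" unfolding xy(5) by (intro fv.span_mono) auto
  ultimately show ?thesis by blast
qed

text \<open>The plane of a good pair in \<open>S\<close> works. A collection without
  \<open>S\<close> misses this plane, whence minimality.\<close>

lemma block_determined_by_plane:
  assumes S: "block S"
  shows "\<exists>W. lsubspace W \<and> W \<subseteq> V \<and> ldim W = 2 \<and> (\<forall>S'. block S'
      \<and> W \<subseteq> S' \<longrightarrow> S' = S)"
proof -
  obtain x y where xy: "x \<in> S" "y \<in> S" "x \<otimes> y \<notin> fv.span {x, y}" using block_generators[OF S] .
  have "S' = S" if "block S'" "fv.span {x, y} \<subseteq> S'" for S'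
  proof -
    have "x \<in> S'" "y \<in> S'" using that(2) by (auto intro: fv.span_base)
    with that(1) xy(3) show ?thesis using block_eq_span S xy(1,2) by metis
  qed
  moreover have "fv.span {x, y} \<subseteq> V" using xy S subspace_V by (intro fv.span_minimal) (auto simp: block_def)
  moreover have "ldim (fv.span {x, y}) = 2" using cr_not_in_span_independent[OF xy(3)] by (rule dim_span_2)
  ultimately show ?thesis by (intro exI[of _ "fv.span {x, y}"]) auto
qed

lemma block_unique_iff_anisotropic:
  "(\<forall>W. lsubspace W \<and> W \<subseteq> V \<and> ldim W = 2 \<longrightarrow> (\<exists>!S. block S
      \<and> W \<subseteq> S)) \<longleftrightarrow> (\<forall>x\<in>V. ip x x = 0 \<longrightarrow> x = 0)"
proof (intro iffI ballI impI allI)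
  fix x
  assume uniq: "\<forall>W. lsubspace W \<and> W \<subseteq> V \<and> ldim W
      = 2 \<longrightarrow> (\<exists>!S. block S \<and> W \<subseteq> S)"
    and x: "x \<in> V" "ip x x = 0"
  show "x = 0"
  proof (rule ccontr)
    assume x0: "x \<noteq> 0"
    \<comment> \<open>The plane of \<open>x\<close> and an annihilated \<open>z\<close> will lie in
      two blocks.\<close>
    obtain z where z: "z \<in> V" "z \<notin> fv.span {x}" "x \<otimes> z = 0"
      using isotropic_annihilator[OF x(1) x0 x(2)] by blast
    obtain u v where uv: "u \<in> V" "v \<in> V" "asc x z u = 0" "asc x z v = 0"
        "u \<notin> fv.span {x, z}" "v \<notin> fv.span {x, z, u}"
      using annihilating_pair_nucleus[OF x(1) z(1,3)] by blast
    have v: "v \<notin> fv.span {x, z}" using uv(6) fv.span_mono[of "{x, z}" "{x, z, u}"] by blast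
    have "block (fv.span {x, z, u})" by (rule block_span[OF x(1) z(1) uv(1,3) x0 z(2) uv(5)])
    moreover have "block (fv.span {x, z, v})" by (rule block_span[OF x(1) z(1) uv(2,4) x0 z(2) v])
    moreover have "fv.span {x, z} \<subseteq> fv.span {x, z, u}" "fv.span {x, z} \<subseteq> fv.span {x, z, v}"
      by (intro fv.span_mono; auto)+
    moreover have "fv.span {x, z} \<subseteq> V" using x z subspace_V by (intro fv.span_minimal) auto
    then have "\<exists>!S. block S \<and> fv.span {x, z} \<subseteq> S" using uniq dim_span_2[OF x0 z(2)] by auto
    ultimately have "fv.span {x, z, u} = fv.span {x, z, v}" by blast
    moreover have "v \<in> fv.span {x, z, v}" by (auto intro: fv.span_base)
    ultimately show False using uv(6) by blast
  qed
next
  fix W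
  assume anis: "\<forall>x\<in>V. ip x x = 0 \<longrightarrow> x = 0" and W: "lsubspace W \<and> W \<subseteq> V
      \<and> ldim W = 2"
  obtain x y where xy: "x \<in> W" "y \<in> W" "x \<noteq> 0" "y \<notin> fv.span {x}" "W = fv.span {x, y}"
    using plane_basis W by blast
  have V: "x \<in> V" "y \<in> V" using xy W by auto
  \<comment> \<open>A plane containing its product is degenerate, and its radical vector would be
    isotropic.\<close>
  have w: "x \<otimes> y \<notin> fv.span {x, y}"
  proof
    assume "x \<otimes> y \<in> fv.span {x, y}"
    then have "ip x x * ip y y = ip x y * ip x y" using cr_in_span_degenerate V by blast
    from degenerate_basis[OF V this xy(3,4)] anis show False by metis
  qed
  obtain S where S: "block S" "W \<subseteq> S" using blocks_cover W by blast
  have eq: "S' = fv.span {x, y, x \<otimes> y}" if "block S'" "W \<subseteq> S'" for S'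
    using block_eq_span[OF that(1) _ _ w] that(2) xy(1,2) by blast
  show "\<exists>!S. block S \<and> W \<subseteq> S"
  proof (rule ex1I[of _ S])
    show "block S \<and> W \<subseteq> S" using S by blast
    show "S' = S" if "block S' \<and> W \<subseteq> S'" for S' using eq[of S'] eq[of S] S that by simp
  qed
qed

text \<open>A block is generated by a good pair \<open>x\<close>, \<open>y\<close> and
  \<open>w = x \<otimes> y\<close>, whose remaining products \<open>cr_cr\<close> computes.
  Conversely a closed \<open>S\<close> contains these three vectors, equals their span by dimension,
  and \<open>asc_cr\<close> makes that span a block.\<close>

lemma block_iff_cr_closed:
  assumes S: "lsubspace S" "S \<subseteq> V" "ldim S = 3"
  shows "block S \<longleftrightarrow> (\<forall>x\<in>S. \<forall>y\<in>S. x \<otimes> y \<in> S)"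
proof
  assume bl: "block S"
  obtain x y where xy: "x \<in> S" "y \<in> S" "x \<otimes> y \<notin> fv.span {x, y}" using block_generators[OF bl] .
  have V: "x \<in> V" "y \<in> V" using xy S by auto
  define w where "w = x \<otimes> y"
  have Seq: "S = fv.span {x, y, w}" unfolding w_def by (rule block_eq_span[OF bl xy])
  have span: "x \<in> S" "y \<in> S" "w \<in> S" unfolding Seq by (auto intro: fv.span_base)
  note closed = fv.subspace_add[OF S(1)] fv.subspace_scale[OF S(1)] fv.subspace_neg[OF S(1)] fv.subspace_0[OF S(1)]
  have xw: "x \<otimes> w \<in> S" unfolding w_def cr_cr[OF V] using span by (intro closed)
  have "w \<otimes> y \<in> S" unfolding w_def cr_cr_right[OF V(2,1)] using span by (intro closed)
  then have yw: "y \<otimes> w \<in> S" unfolding cr_skew[of y w] by (rule closed)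
  have gens: "s \<otimes> t \<in> S" if "s \<in> {x, y, w}" "t \<in> {x, y, w}" for s t
    using that span xw yw cr_skew[of y x] cr_skew[of w x] cr_skew[of w y] w_def closed by (auto simp: cr_self)
  show "\<forall>x\<in>S. \<forall>y\<in>S. x \<otimes> y \<in> S"
  proof (intro ballI)
    fix u v assume "u \<in> S" "v \<in> S"
    then obtain a b c a' b' c' where u: "u = sc a x + sc b y + sc c w" and v: "v = sc a' x + sc b' y + sc c' w"
      unfolding Seq in_span_3 by blast
    have 1: "s \<otimes> v \<in> S" if "s \<in> {x, y, w}" for s
      unfolding v cr_add_right cr_sc_right using gens[OF that] by (intro closed) simp_all
    show "u \<otimes> v \<in> S" unfolding u cr_add_left cr_sc_left using 1 by (intro closed) simp_all
  qed
next
  assume cl: "\<forall>x\<in>S. \<forall>y\<in>S. x \<otimes> y \<in> S"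
  obtain x y where xy: "x \<in> S" "y \<in> S" "x \<otimes> y \<notin> fv.span {x, y}"
    using exists_cr_not_in_span[OF S] by blast
  note li = cr_not_in_span_independent[OF xy(3)]
  have V: "x \<in> V" "y \<in> V" using xy S by auto
  define w where "w = x \<otimes> y"
  have bl: "block (fv.span {x, y, w})" unfolding w_def using V li xy(3) by (intro block_span) auto
  have "w \<notin> fv.span {y, x}" using xy(3) by (simp add: insert_commute w_def)
  note ind = independent_3[OF li this]
  have "S \<subseteq> fv.span {w, y, x}"
  proof
    fix z assume z: "z \<in> S"
    show "z \<in> fv.span {w, y, x}"
    proof (rule ccontr)
      assume "z \<notin> fv.span {w, y, x}"
      with independent_insert_card[OF ind(1) _ this] ind(2)
      have "fv.independent {z, w, y, x}" "card {z, w, y, x} = 4" by auto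
      moreover have "{z, w, y, x} \<subseteq> S" using z xy cl by (auto simp: w_def)
      moreover obtain b where b: "fv.independent b" "S \<subseteq> fv.span b" "card b = 3"
        using fv.basis_exists[of S] S(3) by metis
      moreover have "finite b" using b(3) by (intro card_ge_0_finite) simp
      ultimately have "4 \<le> (3::nat)" using fv.independent_span_bound[of b "{z, w, y, x}"] by auto
      then show False by simp
    qed
  qed
  moreover have "fv.span {w, y, x} \<subseteq> S" using S xy cl by (intro fv.span_minimal) (auto simp: w_def)
  ultimately have "S = fv.span {x, y, w}" by (simp add: insert_commute)
  with bl show "block S" by simp
qed

end

section \<open>Cayley algebras in coordinates\<close>

lemma less_4_nat: "(i::nat) < 4 \<longleftrightarrow> i = 0 \<or> i = 1 \<or> i = 2 \<or> i = 3" by auto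

lemma less_8_nat: "(i::nat) < 8 \<longleftrightarrow> i = 0 \<or> i = 1 \<or> i = 2 \<or> i = 3 \<or> i
    = 4 \<or> i = 5 \<or> i = 6 \<or> i = 7"
  by auto

lemma cd_conj_1: "cd_conj 1 x = (\<lambda>i. if i = 0 then x 0 else if i = 1 then - x 1 else 0)"
  by (rule ext) (auto simp: cd_join_def cd_fst_def cd_snd_def)

lemma cd_mult_1: "cd_mult gs 1 x y = (\<lambda>i. if i = 0 then x 0 * y 0 + gs!0 * x 1 * y 1 else if i
    = 1 then x 0 * y 1 + x 1 * y 0 else 0)"
  by (rule ext) (auto simp: cd_join_def cd_fst_def cd_snd_def sc_def Let_def)

lemma cd_conj_2: "cd_conj 2 x = (\<lambda>i. if i = 0 then x 0 else if i < 4 then - x i else 0)" (is "_ = ?R")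
proof -
  have "cd_conj (Suc 1) x i = ?R i" for i
  proof -
    have "i \<ge> 4 \<or> i < 4" by linarith
    then show ?thesis
      unfolding cd_conj.simps(2)[of 1] cd_conj_1 less_4_nat
      by (elim disjE) (simp_all add: cd_join_def cd_fst_def cd_snd_def del: add_2_eq_Suc add_2_eq_Suc')
  qed
  then show ?thesis by (simp only: Suc_1 fun_eq_iff simp_thms)
qed

lemma cd_mult_2: "cd_mult gs 2 x y = (\<lambda>i.
  if i = 0 then x 0 * y 0 + gs!0 * x 1 * y 1 + gs!1 * x 2 * y 2 - gs!0 * gs!1 * x 3 * y 3 else
  if i = 1 then x 0 * y 1 + x 1 * y 0 + gs!1 * x 2 * y 3 - gs!1 * x 3 * y 2 else
  if i = 2 then x 0 * y 2 - gs!0 * x 1 * y 3 + x 2 * y 0 + gs!0 * x 3 * y 1 else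
  if i = 3 then x 0 * y 3 - x 1 * y 2 + x 2 * y 1 + x 3 * y 0 else 0)" (is "_ = ?R")
proof -
  \<comment> \<open>Writing the level as a successor unfolds exactly one doubling, on top of the
    closed formula for the level below.\<close>
  have "cd_mult gs (Suc 1) x y i = ?R i" for i
  proof -
    have "i \<ge> 4 \<or> i < 4" by linarith
    then show ?thesis
      unfolding cd_mult.simps(2)[of gs 1] cd_mult_1 cd_conj_1 Let_def less_4_nat
      apply (elim disjE)
      apply (simp_all add: cd_join_def cd_fst_def cd_snd_def sc_def del: add_2_eq_Suc add_2_eq_Suc')
      apply (simp_all add: algebra_simps)
      done
  qed
  then show ?thesis by (simp only: Suc_1 fun_eq_iff simp_thms)
qed

lemma oct_conj_coords: "oct_conj x = (\<lambda>i. if i = 0 then x 0 else if i < 8 then - x i else 0)"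
proof -
  have "oct_conj x = cd_conj (Suc 2) x" by (simp add: oct_conj_def eval_nat_numeral)
  then show ?thesis
    unfolding cd_conj.simps(2)[of 2] cd_conj_2
    by (auto simp: cd_join_def cd_fst_def cd_snd_def fun_eq_iff)
qed

lemma oct_mult_coords: "oct_mult \<alpha> \<beta> \<gamma> x y = (\<lambda>i.
  if i = 0 then x 0 * y 0 + \<alpha> * x 1 * y 1 + \<beta> * x 2 * y 2 - \<alpha> * \<beta> * x 3 * y 3
      + \<gamma> * x 4 * y 4 - \<alpha> * \<gamma> * x 5 * y 5 - \<beta> * \<gamma> * x 6 * y 6
      + \<alpha> * \<beta> * \<gamma> * x 7 * y 7 else
  if i = 1 then x 0 * y 1 + x 1 * y 0 + \<beta> * x 2 * y 3 - \<beta> * x 3 * y 2 + \<gamma> * x 4 * y 5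
      - \<gamma> * x 5 * y 4 + \<beta> * \<gamma> * x 6 * y 7 - \<beta> * \<gamma> * x 7 * y 6 else
  if i = 2 then x 0 * y 2 - \<alpha> * x 1 * y 3 + x 2 * y 0 + \<alpha> * x 3 * y 1 + \<gamma> * x 4 * y 6
      - \<alpha> * \<gamma> * x 5 * y 7 - \<gamma> * x 6 * y 4 + \<alpha> * \<gamma> * x 7 * y 5 else
  if i = 3 then x 0 * y 3 - x 1 * y 2 + x 2 * y 1 + x 3 * y 0 + \<gamma> * x 4 * y 7 - \<gamma> * x 5 * y 6
      + \<gamma> * x 6 * y 5 - \<gamma> * x 7 * y 4 else
  if i = 4 then x 0 * y 4 - \<alpha> * x 1 * y 5 - \<beta> * x 2 * y 6 + \<alpha> * \<beta> * x 3 * y 7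
      + x 4 * y 0 + \<alpha> * x 5 * y 1 + \<beta> * x 6 * y 2 - \<alpha> * \<beta> * x 7 * y 3 else
  if i = 5 then x 0 * y 5 - x 1 * y 4 - \<beta> * x 2 * y 7 + \<beta> * x 3 * y 6 + x 4 * y 1 + x 5 * y 0
      - \<beta> * x 6 * y 3 + \<beta> * x 7 * y 2 else
  if i = 6 then x 0 * y 6 + \<alpha> * x 1 * y 7 - x 2 * y 4 - \<alpha> * x 3 * y 5 + x 4 * y 2
      + \<alpha> * x 5 * y 3 + x 6 * y 0 - \<alpha> * x 7 * y 1 else
  if i = 7 then x 0 * y 7 + x 1 * y 6 - x 2 * y 5 - x 3 * y 4 + x 4 * y 3 + x 5 * y 2 - x 6 * y 1
      + x 7 * y 0 else 0)" (is "_ = ?R")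
proof -
  have "cd_mult [\<alpha>, \<beta>, \<gamma>] (Suc 2) x y i = ?R i" for i
  proof -
    have "i \<ge> 8 \<or> i < 8" by linarith
    then show ?thesis
      unfolding cd_mult.simps(2)[of _ 2] cd_mult_2 cd_conj_2 Let_def less_8_nat
      apply (elim disjE)
      apply (simp_all add: cd_join_def cd_fst_def cd_snd_def sc_def)
      apply (simp_all add: algebra_simps)
      done
  qed
  moreover have "oct_mult \<alpha> \<beta> \<gamma> x y = cd_mult [\<alpha>, \<beta>, \<gamma>] (Suc 2) x y"
    unfolding oct_mult_def by (rule arg_cong[of 3 "Suc 2" "\<lambda>n. cd_mult _ n x y"]) simp
  ultimately show ?thesis by (simp only: fun_eq_iff simp_thms)
qed

section \<open>The form and the cross product in coordinates\<close>

context fixes \<alpha> \<beta> \<gamma> :: "'f::field" begin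

text \<open>Minus the scalar part of a product of imaginary elements, that is, the bilinear form of
  the norm; the coefficients are the negated squares of the basis elements.\<close>

definition im_form :: "(nat \<Rightarrow> 'f) \<Rightarrow> (nat \<Rightarrow> 'f) \<Rightarrow> 'f" where
  "im_form x y = - \<alpha> * x 1 * y 1 - \<beta> * x 2 * y 2 + \<alpha> * \<beta> * x 3 * y 3
      - \<gamma> * x 4 * y 4 + \<alpha> * \<gamma> * x 5 * y 5
     + \<beta> * \<gamma> * x 6 * y 6 - \<alpha> * \<beta> * \<gamma> * x 7 * y 7"

text \<open>The imaginary part of the product without the terms in coordinate 0, so that it sees
  only imaginary parts.\<close>

definition im_cross :: "(nat \<Rightarrow> 'f) \<Rightarrow> (nat \<Rightarrow> 'f) \<Rightarrow> (nat \<Rightarrow> 'f)" where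
  "im_cross x y = (\<lambda>i.
  if i = 1 then \<beta> * x 2 * y 3 - \<beta> * x 3 * y 2 + \<gamma> * x 4 * y 5 - \<gamma> * x 5 * y 4
      + \<beta> * \<gamma> * x 6 * y 7 - \<beta> * \<gamma> * x 7 * y 6 else
  if i = 2 then - \<alpha> * x 1 * y 3 + \<alpha> * x 3 * y 1 + \<gamma> * x 4 * y 6
      - \<alpha> * \<gamma> * x 5 * y 7 - \<gamma> * x 6 * y 4 + \<alpha> * \<gamma> * x 7 * y 5 else
  if i = 3 then - x 1 * y 2 + x 2 * y 1 + \<gamma> * x 4 * y 7 - \<gamma> * x 5 * y 6 + \<gamma> * x 6 * y 5
      - \<gamma> * x 7 * y 4 else
  if i = 4 then - \<alpha> * x 1 * y 5 - \<beta> * x 2 * y 6 + \<alpha> * \<beta> * x 3 * y 7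
      + \<alpha> * x 5 * y 1 + \<beta> * x 6 * y 2 - \<alpha> * \<beta> * x 7 * y 3 else
  if i = 5 then - x 1 * y 4 - \<beta> * x 2 * y 7 + \<beta> * x 3 * y 6 + x 4 * y 1 - \<beta> * x 6 * y 3
      + \<beta> * x 7 * y 2 else
  if i = 6 then \<alpha> * x 1 * y 7 - x 2 * y 4 - \<alpha> * x 3 * y 5 + x 4 * y 2 + \<alpha> * x 5 * y 3
      - \<alpha> * x 7 * y 1 else
  if i = 7 then x 1 * y 6 - x 2 * y 5 - x 3 * y 4 + x 4 * y 3 + x 5 * y 2 - x 6 * y 1 else 0)"

lemma im_cross_coords:
  "im_cross x y 0 = 0" "i \<ge> 8 \<Longrightarrow> im_cross x y i = 0"
  by (simp_all add: im_cross_def)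

lemma oct_im_iff:
  assumes "(2::'f) \<noteq> 0" shows "(x :: nat \<Rightarrow> 'f) \<in> oct_im \<longleftrightarrow> x 0 = 0
      \<and> (\<forall>i\<ge>8. x i = 0)"
proof
  assume x: "x \<in> oct_im"
  then have "oct_conj x 0 = - x 0" by (simp add: oct_im_def)
  then have "2 * x 0 = 0" by (simp add: oct_conj_coords eq_neg_iff_add_eq_0)
  with x assms show "x 0 = 0 \<and> (\<forall>i\<ge>8. x i = 0)" by (auto simp: oct_im_def oct_carrier_def)
qed (auto simp: oct_im_def oct_carrier_def oct_conj_coords)

lemma im_form_assoc: "im_form (im_cross x y) z = im_form x (im_cross y z)"
  by (simp add: im_form_def im_cross_def algebra_simps)

lemma im_cross_cross:
  assumes "x 0 = 0" "\<forall>i\<ge>8. x i = 0" "z 0 = 0" "\<forall>i\<ge>8. z i = 0"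
  shows "im_cross x (im_cross x z) = sc (- im_form x x) z + sc (im_form x z) x"
proof
  fix i :: nat
  have "i < 8 \<or> i \<ge> 8" by linarith
  then show "im_cross x (im_cross x z) i = (sc (- im_form x x) z + sc (im_form x z) x) i"
    unfolding less_8_nat
    apply (elim disjE)
    apply (simp_all add: sc_def im_cross_def assms)
    apply (simp_all add: im_form_def algebra_simps)
    done
qed

lemma oct_mult_split:
  assumes "x \<in> oct_carrier" "y \<in> oct_carrier"
  shows "oct_mult \<alpha> \<beta> \<gamma> x y = sc (x 0 * y 0 - im_form x y) oct_one + sc (x 0) (y(0:=0))
      + sc (y 0) (x(0:=0)) + im_cross x y"
proof
  fix i :: nat
  have "i < 8 \<or> i \<ge> 8" by linarith
  then show "oct_mult \<alpha> \<beta> \<gamma> x y i = (sc (x 0 * y 0 - im_form x y) oct_one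
      + sc (x 0) (y(0:=0)) + sc (y 0) (x(0:=0)) + im_cross x y) i"
    unfolding less_8_nat using assms
    apply (elim disjE)
    apply (simp_all add: oct_mult_coords sc_def oct_one_def im_cross_def im_form_def oct_carrier_def)
    done
qed

end

definition unit_vec :: "nat \<Rightarrow> nat \<Rightarrow> 'f::field" where
  "unit_vec i = (\<lambda>j. if j = i then 1 else 0)"

lemma independent_unit_vecs:
  "fv.independent (unit_vec ` {1..n} :: (nat \<Rightarrow> 'f::field) set)
      \<and> card (unit_vec ` {1..n} :: (nat \<Rightarrow> 'f) set) = n"
proof (induction n)
  case 0
  then show ?case by (simp add: fv.independent_empty)
next
  case (Suc n)
  let ?E = "unit_vec ` {1..n} :: (nat \<Rightarrow> 'f) set"
  have "fv.span ?E \<subseteq> {v. v (Suc n) = 0}"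
    by (rule fv.span_minimal) (auto simp: unit_vec_def fv.subspace_def sc_def)
  moreover have "(unit_vec (Suc n) :: nat \<Rightarrow> 'f) (Suc n) \<noteq> 0" by (simp add: unit_vec_def)
  ultimately have "unit_vec (Suc n) \<notin> fv.span ?E" by blast
  moreover have "unit_vec ` {1..Suc n} = insert (unit_vec (Suc n)) ?E" by (simp add: atLeastAtMostSuc_conv)
  ultimately show ?case using independent_insert_card[of ?E "unit_vec (Suc n)"] Suc by simp
qed

lemma im_decomposition:
  assumes "x 0 = 0" "\<forall>i\<ge>8. x i = 0"
  shows "x = sc (x 1) (unit_vec 1) + sc (x 2) (unit_vec 2) + sc (x 3) (unit_vec 3) + sc (x 4) (unit_vec 4)
    + sc (x 5) (unit_vec 5) + sc (x 6) (unit_vec 6) + sc (x 7) (unit_vec 7)"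
proof
  fix i :: nat
  have "i < 8 \<or> i \<ge> 8" by linarith
  then show "x i = (sc (x 1) (unit_vec 1) + sc (x 2) (unit_vec 2) + sc (x 3) (unit_vec 3) + sc (x 4) (unit_vec 4)
    + sc (x 5) (unit_vec 5) + sc (x 6) (unit_vec 6) + sc (x 7) (unit_vec 7)) i"
    unfolding less_8_nat using assms by (elim disjE) (simp_all add: sc_def unit_vec_def)
qed

lemma cross_space_oct_im:
  fixes \<alpha> \<beta> \<gamma> :: "'f::field"
  assumes two: "(2::'f) \<noteq> 0" and nz: "\<alpha> \<noteq> 0" "\<beta> \<noteq> 0" "\<gamma> \<noteq> 0"
  shows "cross_space oct_im (im_form \<alpha> \<beta> \<gamma>) (im_cross \<alpha> \<beta> \<gamma>)"
proof
  note im = oct_im_iff[OF two]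
  show "(2::'f) \<noteq> 0" by fact
  show sub: "lsubspace (oct_im :: (nat \<Rightarrow> 'f) set)"
    by (auto simp: fv.subspace_def im sc_def)
  show "ldim (oct_im :: (nat \<Rightarrow> 'f) set) = 7"
  proof (rule fv.dim_unique)
    show "unit_vec ` {1..7} \<subseteq> (oct_im :: (nat \<Rightarrow> 'f) set)" by (auto simp: im unit_vec_def)
    show "oct_im \<subseteq> fv.span (unit_vec ` {1..7} :: (nat \<Rightarrow> 'f) set)"
    proof
      fix x :: "nat \<Rightarrow> 'f" assume "x \<in> oct_im"
      then have "x 0 = 0" "\<forall>i\<ge>8. x i = 0" using im by auto
      then show "x \<in> fv.span (unit_vec ` {1..7})"
        by (subst im_decomposition[of x]) (simp_all add: fv.span_add fv.span_scale fv.span_base)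
    qed
  qed (use independent_unit_vecs[of 7] in auto)
  show "im_form \<alpha> \<beta> \<gamma> (x + y) z = im_form \<alpha> \<beta> \<gamma> x z
      + im_form \<alpha> \<beta> \<gamma> y z" for x y z
    by (simp add: im_form_def algebra_simps)
  show "im_form \<alpha> \<beta> \<gamma> (sc c x) z = c * im_form \<alpha> \<beta> \<gamma> x z" for c x z
    by (simp add: im_form_def sc_def algebra_simps)
  show "im_form \<alpha> \<beta> \<gamma> x y = im_form \<alpha> \<beta> \<gamma> y x" for x y
    by (simp add: im_form_def algebra_simps)
  show "\<exists>p\<in>oct_im. \<forall>v\<in>oct_im. im_form \<alpha> \<beta> \<gamma> p v = f v"
    if add: "\<And>x y. f (x + y) = f x + f y" and scale: "\<And>c x. f (sc c x) = c * f x"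
        for f :: "(nat \<Rightarrow> 'f) \<Rightarrow> 'f"
  proof -
    \<comment> \<open>The form is diagonal, so the values of \<open>f\<close> on the unit vectors
      are divided by the diagonal entries \<open>- \<alpha>\<close>, \<open>- \<beta>\<close>,
      \<open>\<alpha> * \<beta>\<close> and so on.\<close>
    define p :: "nat \<Rightarrow> 'f" where "p = (\<lambda>i. if i = 1 then - f (unit_vec 1) / \<alpha> else
        if i = 2 then - f (unit_vec 2) / \<beta>
      else if i = 3 then f (unit_vec 3) / (\<alpha> * \<beta>) else if i = 4 then - f (unit_vec 4) / \<gamma>
      else if i = 5 then f (unit_vec 5) / (\<alpha> * \<gamma>) else if i
          = 6 then f (unit_vec 6) / (\<beta> * \<gamma>)
      else if i = 7 then - f (unit_vec 7) / (\<alpha> * \<beta> * \<gamma>) else 0)"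
    have "p \<in> oct_im" by (simp add: im p_def)
    moreover have "im_form \<alpha> \<beta> \<gamma> p v = f v" if "v \<in> oct_im" for v
    proof -
      have "v 0 = 0" "\<forall>i\<ge>8. v i = 0" using that im by auto
      then have "f v = v 1 * f (unit_vec 1) + v 2 * f (unit_vec 2) + v 3 * f (unit_vec 3) + v 4 * f (unit_vec 4)
          + v 5 * f (unit_vec 5) + v 6 * f (unit_vec 6) + v 7 * f (unit_vec 7)"
        by (subst im_decomposition[of v]) (simp_all only: add scale)
      then show ?thesis using nz by (simp add: im_form_def p_def)
    qed
    ultimately show ?thesis by blast
  qed
  show "im_cross \<alpha> \<beta> \<gamma> x y \<in> oct_im" for x y
    by (simp add: im im_cross_coords)
  show "im_cross \<alpha> \<beta> \<gamma> x x = 0" for x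
    by (simp add: im_cross_def fun_eq_iff)
  show "im_cross \<alpha> \<beta> \<gamma> (x + y) z = im_cross \<alpha> \<beta> \<gamma> x z
      + im_cross \<alpha> \<beta> \<gamma> y z" for x y z
    by (simp add: im_cross_def fun_eq_iff algebra_simps)
  show "im_cross \<alpha> \<beta> \<gamma> x (y + z) = im_cross \<alpha> \<beta> \<gamma> x y
      + im_cross \<alpha> \<beta> \<gamma> x z" for x y z
    by (simp add: im_cross_def fun_eq_iff algebra_simps)
  show "im_cross \<alpha> \<beta> \<gamma> (sc c x) z = sc c (im_cross \<alpha> \<beta> \<gamma> x z)" for c x z
    by (simp add: im_cross_def sc_def fun_eq_iff algebra_simps)
  show "im_cross \<alpha> \<beta> \<gamma> x (sc c z) = sc c (im_cross \<alpha> \<beta> \<gamma> x z)" for c x z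
    by (simp add: im_cross_def sc_def fun_eq_iff algebra_simps)
  show "im_form \<alpha> \<beta> \<gamma> (im_cross \<alpha> \<beta> \<gamma> x y) z
      = im_form \<alpha> \<beta> \<gamma> x (im_cross \<alpha> \<beta> \<gamma> y z)" for x y z
    by (rule im_form_assoc)
  show "im_cross \<alpha> \<beta> \<gamma> x (im_cross \<alpha> \<beta> \<gamma> x z)
      = sc (- im_form \<alpha> \<beta> \<gamma> x x) z + sc (im_form \<alpha> \<beta> \<gamma> x z) x"
    if "x \<in> oct_im" "z \<in> oct_im" for x z
    using that by (intro im_cross_cross) (auto simp: im)
qed

section \<open>Translation between the cross product and the algebra\<close>

locale cayley_algebra =
  fixes \<alpha> \<beta> \<gamma> :: "'f::field"
  assumes char: "(2::'f) \<noteq> 0" and nz: "\<alpha> \<noteq> 0" "\<beta> \<noteq> 0" "\<gamma> \<noteq> 0"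
begin

sublocale cross_space oct_im "im_form \<alpha> \<beta> \<gamma>" "im_cross \<alpha> \<beta> \<gamma>"
  using char nz by (rule cross_space_oct_im)

abbreviation "ip \<equiv> im_form \<alpha> \<beta> \<gamma>"
abbreviation cr (infixl \<open>\<otimes>\<close> 70) where "cr \<equiv> im_cross \<alpha> \<beta> \<gamma>"
abbreviation mult where "mult \<equiv> oct_mult \<alpha> \<beta> \<gamma>"

lemmas im_iff = oct_im_iff[OF char]

lemma mult_scalar_plus_im:
  assumes "x \<in> oct_im" "y \<in> oct_im"
  shows "mult (sc a oct_one + x) (sc b oct_one + y) = sc (a * b - ip x y) oct_one + (sc a y + sc b x + x \<otimes> y)"
proof -
  have V: "x 0 = 0" "\<forall>i\<ge>8. x i = 0" "y 0 = 0" "\<forall>i\<ge>8. y i = 0" using assms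
      by (simp_all add: im_iff)
  have carr: "sc a oct_one + x \<in> oct_carrier" "sc b oct_one + y \<in> oct_carrier"
    using V by (auto simp: oct_carrier_def sc_def oct_one_def)
  have 0: "(sc a oct_one + x) 0 = a" "(sc b oct_one + y) 0 = b"
    using V by (auto simp: sc_def oct_one_def)
  have 1: "(sc a oct_one + x)(0 := 0) = x" "(sc b oct_one + y)(0 := 0) = y"
    using V by (auto simp: sc_def oct_one_def fun_eq_iff)
  have 2: "ip (sc a oct_one + x) (sc b oct_one + y) = ip x y"
    by (simp add: im_form_def sc_def oct_one_def)
  have 3: "(sc a oct_one + x) \<otimes> (sc b oct_one + y) = x \<otimes> y"
    by (simp add: im_cross_def sc_def oct_one_def fun_eq_iff)
  show ?thesis
    unfolding oct_mult_split[OF carr] 0 1 2 3 by (simp only: add.assoc)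
qed

lemma scalar_plus_im_eq_iff:
  assumes "(x :: nat \<Rightarrow> 'f) \<in> oct_im" "y \<in> oct_im"
  shows "sc a oct_one + x = sc b oct_one + y \<longleftrightarrow> a = b \<and> x = y"
proof
  assume e: "sc a oct_one + x = sc b oct_one + y"
  have "x 0 = 0" "y 0 = 0" using assms by (simp_all add: im_iff)
  then have "a = b" using fun_cong[OF e, of 0] by (simp add: sc_def oct_one_def)
  with e show "a = b \<and> x = y" by simp
qed simp

lemma carrier_decomposition:
  assumes "(x :: nat \<Rightarrow> 'f) \<in> oct_carrier"
  obtains a u where "u \<in> oct_im" "x = sc a oct_one + u"
proof
  show "x(0 := 0) \<in> oct_im" using assms by (auto simp: im_iff oct_carrier_def)
  show "x = sc (x 0) oct_one + x(0 := 0)" by (auto simp: fun_eq_iff sc_def oct_one_def)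
qed

text \<open>The scalar parts of both bracketings agree by \<open>ip_cr\<close>. Rotation expresses
  \<open>x \<otimes> (y \<otimes> z)\<close> through \<open>- asc x y z\<close>, so the imaginary
  parts differ by \<open>2 asc x y z\<close>.\<close>

lemma associative_iff_asc:
  assumes V: "x \<in> oct_im" "y \<in> oct_im" "z \<in> oct_im"
  shows "mult (mult x y) z = mult x (mult y z) \<longleftrightarrow> asc x y z = 0"
proof -
  have m: "mult u v = sc (- ip u v) oct_one + u \<otimes> v" if "u \<in> oct_im" "v \<in> oct_im" for u v
    using mult_scalar_plus_im[OF that, of 0 0] by simp
  have l: "mult (mult x y) z = sc (- ip (x \<otimes> y) z) oct_one + (sc (- ip x y) z + (x \<otimes> y) \<otimes> z)"
    using mult_scalar_plus_im[of "x \<otimes> y" z "- ip x y" 0] V by (simp add: m)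
  have r: "mult x (mult y z) = sc (- ip x (y \<otimes> z)) oct_one + (sc (- ip y z) x + x \<otimes> (y \<otimes> z))"
    using mult_scalar_plus_im[of x "y \<otimes> z" 0 "- ip y z"] V by (simp add: m)
  have "asc x y z = (y \<otimes> z) \<otimes> x - sc (ip y x) z + sc (ip z x) y"
    using asc_rotate(1)[OF V] unfolding asc_def[of y z x] by simp
  then have x_yz: "x \<otimes> (y \<otimes> z) = - asc x y z - sc (ip y x) z + sc (ip z x) y"
    by (simp add: cr_skew[of "y \<otimes> z" x])
  have xy_z: "(x \<otimes> y) \<otimes> z = asc x y z + sc (ip x z) y - sc (ip y z) x" by (simp add: asc_def)
  have diff: "sc (- ip x y) z + (x \<otimes> y) \<otimes> z - (sc (- ip y z) x + x \<otimes> (y \<otimes> z))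
      = sc 2 (asc x y z)"
    unfolding x_yz xy_z by (simp add: fun_eq_iff sc_def ip_sym[of y x] ip_sym[of z x] algebra_simps)
  have "mult (mult x y) z = mult x (mult y z) \<longleftrightarrow>
      sc (- ip x y) z + (x \<otimes> y) \<otimes> z = sc (- ip y z) x + x \<otimes> (y \<otimes> z)"
    unfolding l r using V by (subst scalar_plus_im_eq_iff) (auto simp: ip_cr)
  also have "\<dots> \<longleftrightarrow> sc 2 (asc x y z) = 0" unfolding diff[symmetric]
      by (rule right_minus_eq[symmetric])
  also have "\<dots> \<longleftrightarrow> asc x y z = 0" using char by (simp only: fv.scale_eq_0_iff simp_thms)
  finally show ?thesis .
qed

lemma block_iff_associative_subspace:
  "block S \<longleftrightarrow> lsubspace S \<and> S \<subseteq> oct_im \<and> ldim S = 3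
      \<and> associative_subspace mult S"
proof -
  have "associative_subspace mult S
      \<longleftrightarrow> (\<forall>x\<in>S. \<forall>y\<in>S. \<forall>z\<in>S. asc x y z = 0)"
      if "S \<subseteq> oct_im"
    unfolding associative_subspace_def using that associative_iff_asc by (intro ball_cong refl) blast
  then show ?thesis unfolding block_def by blast
qed

text \<open>For \<open>x = a + u\<close>, multiplying the imaginary part of the equation by
  \<open>u\<close> gives \<open>ip u u = - a * a\<close>: a zero divisor has norm 0. If
  \<open>a = 0\<close> then \<open>u\<close> is isotropic; otherwise \<open>exists_isotropic\<close>
  supplies an imaginary vector.\<close>

lemma mult_eq_0_isotropic:
  assumes x: "x \<in> oct_carrier" "x \<noteq> 0" and y: "y \<in> oct_carrier" "y \<noteq> 0" and xy: "mult x y = 0"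
  shows "\<exists>v\<in>oct_im. v \<noteq> 0 \<and> ip v v = 0"
proof -
  obtain a u where u: "u \<in> oct_im" "x = sc a oct_one + u" using carrier_decomposition[OF x(1)] .
  obtain b v where v: "v \<in> oct_im" "y = sc b oct_one + v" using carrier_decomposition[OF y(1)] .
  have "sc (a * b - ip u v) oct_one + (sc a v + sc b u + u \<otimes> v) = sc 0 oct_one + 0"
    using xy u v by (simp add: mult_scalar_plus_im)
  then have "a * b - ip u v = 0 \<and> sc a v + sc b u + u \<otimes> v = 0"
    using u v by (subst (asm) scalar_plus_im_eq_iff) auto
  then have ab: "ip u v = a * b" and uv: "u \<otimes> v = - sc a v - sc b u"
    by (auto simp: algebra_simps eq_neg_iff_add_eq_0)
  have "u \<otimes> (u \<otimes> v) = - sc a (u \<otimes> v)" by (simp add: uv cr_simps)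
  also have "\<dots> = sc (a * a) v + sc (a * b) u" unfolding uv by (simp add: fun_eq_iff sc_def algebra_simps)
  finally have "sc (- ip u u) v + sc (a * b) u = sc (a * a) v + sc (a * b) u"
    using cr_cr[OF u(1) v(1)] ab by simp
  then have "- ip u u = a * a \<or> v = 0" by (simp only: add_right_cancel fv.scale_cancel_right)
  then have e: "ip u u = - (a * a) \<or> v = 0" by (metis minus_minus)
  have norm: "ip u u = - (a * a)"
  proof (rule ccontr)
    assume "ip u u \<noteq> - (a * a)"
    \<comment> \<open>Here \<open>y\<close> is a nonzero scalar, which cannot be a zero
      divisor.\<close>
    then have v0: "v = 0" using e by blast
    then have "b \<noteq> 0" using v y by auto
    then have "a = 0" "u = 0" using ab uv v0 by (auto simp: ip_simps cr_simps)
    then show False using u x by simp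
  qed
  show ?thesis
  proof (cases "a = 0")
    case True
    then have "u \<noteq> 0" "ip u u = 0" using u x norm by auto
    then show ?thesis using u by blast
  next
    case False
    then show ?thesis using exists_isotropic[OF u(1) norm] by blast
  qed
qed

text \<open>An imaginary \<open>x\<close> squares to \<open>- ip x x\<close>, so a nonzero isotropic
  one is a zero divisor.\<close>

lemma division_algebra_iff_anisotropic:
  "division_algebra mult oct_carrier \<longleftrightarrow> (\<forall>x\<in>oct_im. ip x x
      = 0 \<longrightarrow> x = 0)"
proof
  assume d: "division_algebra mult oct_carrier"
  show "\<forall>x\<in>oct_im. ip x x = 0 \<longrightarrow> x = 0"
  proof (intro ballI impI)
    fix x assume x: "x \<in> oct_im" "ip x x = 0"
    then have "mult x x = 0" using mult_scalar_plus_im[OF x(1) x(1), of 0 0] by (simp add: cr_self)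
    moreover have "x \<in> oct_carrier" using x by (simp add: oct_im_def)
    ultimately show "x = 0" using d unfolding division_algebra_def by blast
  qed
next
  assume "\<forall>x\<in>oct_im. ip x x = 0 \<longrightarrow> x = 0"
  then show "division_algebra mult oct_carrier"
    unfolding division_algebra_def using mult_eq_0_isotropic by blast
qed

lemma dim_span_insert_one:
  assumes S: "lsubspace S" "S \<subseteq> (oct_im :: (nat \<Rightarrow> 'f) set)"
  shows "ldim (fv.span (insert oct_one S)) = Suc (ldim S)"
proof -
  obtain b where b: "b \<subseteq> S" "fv.independent b" "S \<subseteq> fv.span b" "card b = ldim S"
    using fv.basis_exists[of S] by metis
  have fin: "finite b" using b S by (intro independent_card_le(1)[of b]) auto
  have "fv.span b \<subseteq> oct_im" using b S subspace_V by (intro fv.span_minimal) auto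
  moreover have "oct_one \<notin> (oct_im :: (nat \<Rightarrow> 'f) set)" by (simp add: im_iff oct_one_def)
  ultimately have "oct_one \<notin> fv.span b" by blast
  note ind = independent_insert_card[OF b(2) fin this]
  have "fv.span (insert oct_one S) = fv.span (insert oct_one b)"
  proof
    have "S \<subseteq> fv.span (insert oct_one b)" using b(3) fv.span_mono[of b "insert oct_one b"] by blast
    then show "fv.span (insert oct_one S) \<subseteq> fv.span (insert oct_one b)"
      by (intro fv.span_minimal) (auto intro: fv.span_base)
    show "fv.span (insert oct_one b) \<subseteq> fv.span (insert oct_one S)" using b(1) by (intro fv.span_mono) auto
  qed
  then show ?thesis using ind b(4) by (simp add: fv.dim_eq_card_independent)
qed

lemma in_span_insert_one:
  assumes "lsubspace (S :: (nat \<Rightarrow> 'f) set)"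
  shows "x \<in> fv.span (insert oct_one S) \<longleftrightarrow> (\<exists>a u. u \<in> S \<and> x
      = sc a oct_one + u)"
  unfolding fv.span_breakdown_eq fv.span_eq_iff[THEN iffD2, OF assms]
  by (metis add_diff_cancel_left' diff_add_cancel)

text \<open>\<open>S\<close> corresponds to the sum of the scalars and \<open>S\<close>. There a
  product differs from the cross product of the imaginary parts only by elements of that sum, so
  both notions of closure agree.\<close>

lemma block_iff_im_subalgebra:
  "block S \<longleftrightarrow> (\<exists>H. S = H \<inter> oct_im \<and> is_subalgebra mult oct_carrier H
      \<and> ldim H = 4)"
proof
  assume bl: "block S"
  then have S: "lsubspace S" "S \<subseteq> oct_im" "ldim S = 3" by (auto simp: block_def)
  have cl: "u \<otimes> v \<in> S" if "u \<in> S" "v \<in> S" for u v using block_iff_cr_closed[OF S] bl that by blast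
  define H where "H = fv.span (insert oct_one S)"
  note H = in_span_insert_one[OF S(1), folded H_def]
  have "S = H \<inter> oct_im"
  proof
    show "S \<subseteq> H \<inter> oct_im" using S(2) by (auto simp: H_def intro: fv.span_base)
    show "H \<inter> oct_im \<subseteq> S"
    proof
      fix x assume x: "x \<in> H \<inter> oct_im"
      then obtain a u where u: "u \<in> S" "x = sc a oct_one + u" using H by blast
      then have "sc 0 oct_one + x = sc a oct_one + u" by simp
      moreover have "x \<in> oct_im" "u \<in> oct_im" using x u(1) S(2) by auto
      ultimately have "x = u" by (simp only: scalar_plus_im_eq_iff)
      then show "x \<in> S" using u(1) by simp
    qed
  qed
  moreover have "is_subalgebra mult oct_carrier H"
    unfolding is_subalgebra_def
  proof (intro conjI ballI)
    show "lsubspace H" by (simp add: H_def)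
    show "oct_one \<in> H" by (auto simp: H_def intro: fv.span_base)
    show "H \<subseteq> oct_carrier"
    proof
      fix x assume "x \<in> H"
      then obtain a u where u: "u \<in> oct_im" "x = sc a oct_one + u" using H S(2) by blast
      then show "x \<in> oct_carrier" by (simp add: im_iff oct_carrier_def sc_def oct_one_def)
    qed
    fix x y assume "x \<in> H" "y \<in> H"
    then obtain a u b v where uv: "u \<in> S" "x = sc a oct_one + u" "v \<in> S" "y = sc b oct_one + v" using H
        by blast
    then have "mult x y = sc (a * b - ip u v) oct_one + (sc a v + sc b u + u \<otimes> v)"
      using S(2) by (auto intro: mult_scalar_plus_im)
    moreover have "sc a v + sc b u + u \<otimes> v \<in> S"
      using uv cl by (intro fv.subspace_add[OF S(1)] fv.subspace_scale[OF S(1)])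
    ultimately show "mult x y \<in> H" using H by blast
  qed
  moreover have "ldim H = 4" using dim_span_insert_one[OF S(1,2)] S(3) by (simp add: H_def)
  ultimately show "\<exists>H. S = H \<inter> oct_im \<and> is_subalgebra mult oct_carrier H \<and> ldim H = 4"
      by blast
next
  assume "\<exists>H. S = H \<inter> oct_im \<and> is_subalgebra mult oct_carrier H \<and> ldim H = 4"
  then obtain H where H: "S = H \<inter> oct_im" "lsubspace H" "H \<subseteq> oct_carrier" "oct_one \<in> H"
      "\<And>x y. x \<in> H \<Longrightarrow> y \<in> H \<Longrightarrow> mult x y \<in> H" "ldim H = 4"
    unfolding is_subalgebra_def by blast
  have S: "lsubspace S" "S \<subseteq> oct_im" using H subspace_V by (auto simp: fv.subspace_inter)
  have "H = fv.span (insert oct_one S)"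
  proof
    show "fv.span (insert oct_one S) \<subseteq> H" using H by (intro fv.span_minimal) auto
    show "H \<subseteq> fv.span (insert oct_one S)"
    proof
      fix x assume x: "x \<in> H"
      then have "x \<in> oct_carrier" using H by blast
      then obtain a u where u: "u \<in> oct_im" "x = sc a oct_one + u" by (rule carrier_decomposition)
      \<comment> \<open>As \<open>H\<close> contains the unit, it contains the imaginary part of
        each of its elements.\<close>
      have "x - sc a oct_one \<in> H" using x H by (intro fv.subspace_diff fv.subspace_scale)
      then have "u \<in> S" using u H(1) by simp
      with u show "x \<in> fv.span (insert oct_one S)" using in_span_insert_one[OF S(1)] by blast
    qed
  qed
  then have dimS: "ldim S = 3" using dim_span_insert_one[OF S] H(6) by simp
  have "x \<otimes> y \<in> S" if xy: "x \<in> S" "y \<in> S" for x y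
  proof -
    have "mult x y = sc (- ip x y) oct_one + x \<otimes> y"
      using mult_scalar_plus_im[of x y 0 0] xy S(2) by auto
    moreover have "mult x y \<in> H" using xy H by blast
    ultimately have "sc (- ip x y) oct_one + x \<otimes> y - sc (- ip x y) oct_one \<in> H"
      using H by (intro fv.subspace_diff fv.subspace_scale) simp_all
    then show ?thesis by (simp add: H(1))
  qed
  then show "block S" using block_iff_cr_closed[OF S dimS] by blast
qed

end

theorem mainTheorem3:
  fixes \<alpha> \<beta> \<gamma> :: "'f::field"
    and B :: "(nat \<Rightarrow> 'f) set set"
  assumes char: "(2::'f) \<noteq> 0"
    and nz: "\<alpha> \<noteq> 0" "\<beta> \<noteq> 0" "\<gamma> \<noteq> 0"
    and B_def: "B = {S. lsubspace S \<and> S \<subseteq> oct_im \<and> ldim S = 3 \<and>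
                        associative_subspace (oct_mult \<alpha> \<beta> \<gamma>) S}"
  shows "q_covering_design oct_im 7 3 2 B
       \<and> (\<forall>B'. B' \<subset> B \<longrightarrow> \<not> q_covering_design oct_im 7 3 2 B')
       \<and> (q_subspace_design_1 oct_im 2 7 3 B \<longleftrightarrow> division_algebra (oct_mult \<alpha> \<beta> \<gamma>) oct_carrier)
       \<and> B = {H \<inter> oct_im | H. is_subalgebra (oct_mult \<alpha> \<beta> \<gamma>) oct_carrier H \<and> ldim H = 4}"
proof -
  interpret cayley_algebra \<alpha> \<beta> \<gamma> using char nz by unfold_locales
  have B: "S \<in> B \<longleftrightarrow> block S" for S by (simp add: B_def block_iff_associative_subspace)
  have blocks: "\<forall>S\<in>B. lsubspace S \<and> S \<subseteq> oct_im \<and> ldim S = 3" by (simp add: B_def)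
  have "q_covering_design oct_im 7 3 2 B"
    unfolding q_covering_design_def
  proof (intro conjI)
    show "\<forall>W. lsubspace W \<and> W \<subseteq> oct_im \<and> ldim W = 2 \<longrightarrow> (\<exists>S\<in>B. W \<subseteq> S)"
      unfolding Bex_def B using blocks_cover by blast
  qed (fact subspace_V dim_V blocks)+
  moreover have "\<not> q_covering_design oct_im 7 3 2 B'" if B': "B' \<subset> B" for B'
  proof
    assume cov: "q_covering_design oct_im 7 3 2 B'"
    obtain S where S: "S \<in> B" "S \<notin> B'" using B' by blast
    from S(1) obtain W where W: "lsubspace W" "W \<subseteq> oct_im" "ldim W = 2"
        and uniq: "\<And>S'. block S' \<Longrightarrow> W \<subseteq> S' \<Longrightarrow> S' = S"
      unfolding B using block_determined_by_plane by metis
    obtain S' where "S' \<in> B'" "W \<subseteq> S'" using cov W unfolding q_covering_design_def by blast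
    then show False using uniq B' B S(2) by blast
  qed
  moreover have "q_subspace_design_1 oct_im 2 7 3 B \<longleftrightarrow> division_algebra (oct_mult \<alpha> \<beta> \<gamma>) oct_carrier"
    \<comment> \<open>The clauses about \<open>V\<close> and the members of \<open>B\<close> are
      already known; what remains is uniqueness of the block through each plane.\<close>
    unfolding division_algebra_iff_anisotropic block_unique_iff_anisotropic[symmetric] q_subspace_design_1_def B
    by (simp only: eqTrueI[OF subspace_V] eqTrueI[OF dim_V] eqTrueI[OF blocks] simp_thms)
  moreover have "B = {H \<inter> oct_im | H. is_subalgebra (oct_mult \<alpha> \<beta> \<gamma>) oct_carrier H \<and> ldim H = 4}"
    using B block_iff_im_subalgebra by blast
  ultimately show ?thesis by blast
qed

end
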